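(* Let $n\ge 2$ and let $(\mathcal{A},\tau,M,\mathfrak{a}_{\mathcal{A}})$ be an $n$-anchored bundle equipped with an $n$-connection $\nabla$. Let $[\bullet,\ldots,\bullet]^\nabla$ be the $n$-bracket induced by $\nabla$, and let $\mathcal{R}^\nabla$ be the $n$-curvature of $\nabla$. Then $[\bullet,\ldots,\bullet]^\nabla$ satisfies the fundamental identity $$[X_1,\ldots,X_{n-1},[Y_1,\ldots,Y_n]^\nabla]^\nabla=\sum_{k=1}^n[Y_1,\ldots,[X_1,\ldots,X_{n-1},Y_k]^\nabla,\ldots,Y_n]^\nabla$$ for all $X_1,\ldots,X_{n-1},Y_1,\ldots,Y_n\in\Gamma(\mathcal{A})$ if and only if the $n$-Bianchi identity $$\sum_{k=1}^n(-1)^{k+n}\mathcal{R}^\nabla(X_1\wedge\dots\wedge X_{n-1},Y_1\wedge\dots\wedge\hat{Y}_k\wedge\dots\wedge Y_n)(Y_k)+\sum_{\ell=1}^{n-1}(-1)^\ell\nabla_{[Y_1,\ldots,Y_n]^\nabla\wedge X_1\wedge\dots\wedge\hat{X}_\ell\wedge\dots\wedge X_{n-1}}(X_\ell)$$ $$-\sum_{\ell=1}^{n-1}\sum_{k=1}^n(-1)^{k+\ell}\nabla_{Y_1\wedge\dots\wedge\hat{Y}_k\wedge\dots\wedge Y_n}\nabla_{X_1\wedge\dots\wedge\hat{X}_\ell\wedge\dots\wedge X_{n-1}\wedge Y_k}(X_\ell)=0$$ holds for all $X_1,\ldots,X_{n-1},Y_1,\ldots,Y_n\in\Gamma(\ma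thcal{A})$.
   Context: $\tau:\mathcal{A}\to M$ is a smooth vector bundle over a smooth manifold $M$, and $\Gamma(\mathcal{A})$ is its space of smooth sections. A hat denotes omission of a factor. An $n$-anchor is a bundle map $\mathfrak{a}_{\mathcal{A}}:\wedge^{n-1}\mathcal{A}\to TM$, also viewed as a skew-symmetric $C^\infty(M)$-multilinear map $\wedge^{n-1}\Gamma(\mathcal{A})\to\Gamma(TM)$ on sections; $(\mathcal{A},\tau,M,\mathfrak{a}_{\mathcal{A}})$ is then called an $n$-anchored bundle. An $n$-connection is an $\mathbb{R}$-multilinear map $\nabla:\wedge^{n-1}\Gamma(\mathcal{A})\otimes\Gamma(\mathcal{A})\to\Gamma(\mathcal{A})$, $(X_1\wedge\dots\wedge X_{n-1},X)\mapsto\nabla_{X_1\wedge\dots\wedge X_{n-1}}(X)$ (skew-symmetric in $X_1,\dots,X_{n-1}$) such that for all $f\in C^\infty(M)$ $$\nabla_{fX_1\wedge\dots\wedge X_{n-1}}(X)=f\nabla_{X_1\wedge\dots\wedge X_{n-1}}(X),$$ $$\nabla_{X_1\wedge\dots\wedge X_{n-1}}(fX)=f\nabla_{X_1\wedge\dots\wedge X_{n-1}}(X)+\mathfrak{a}_{\mathcal{A}}(X_1\wedge\dots\wedge X_{n-1})(f)X.$$ The induced $n$-bracket is $[X_1,\ldots,X_n]^\nabla:=\sum_{k=1}^n(-1)^{n+k}\nabla_{X_1\wedge\dots\wedge\hat{X}_k\wedge\dots\wedge X_n}(X_k)$. The bracket of decomposable $(n-1)$-vectors (understood as depending on the sections $X_1,\dots,X_{n-1},Y_1,\dots,Y_{n-1}$)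 is $$[X_1\wedge\dots\wedge X_{n-1},Y_1\wedge\dots\wedge Y_{n-1}]:=\sum_{k=1}^{n-1}Y_1\wedge\dots\wedge[X_1,\ldots,X_{n-1},Y_k]^\nabla\wedge\dots\wedge Y_{n-1}.$$ The $n$-curvature is $$\mathcal{R}^\nabla(X_1\wedge\dots\wedge X_{n-1},Y_1\wedge\dots\wedge Y_{n-1})(Z):=\nabla_{X_1\wedge\dots\wedge X_{n-1}}\nabla_{Y_1\wedge\dots\wedge Y_{n-1}}(Z)-\nabla_{Y_1\wedge\dots\wedge Y_{n-1}}\nabla_{X_1\wedge\dots\wedge X_{n-1}}(Z)-\nabla_{[X_1\wedge\dots\wedge X_{n-1},Y_1\wedge\dots\wedge Y_{n-1}]}(Z).$$ *)

theory Defs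
  imports "HOL-Analysis.Analysis" "HOL-Algebra.Module"
begin

section \<open>Smooth functions on open subsets of Euclidean space\<close>

text \<open>
  \<open>Euclidean_space d\<close> consists of the sequences that vanish from index \<open>d\<close> on.  It is used as the
  model space because it includes \<open>d = 0\<close>, unlike the types of class \<open>euclidean_space\<close>.
  As \<open>U\<close> is open in it, \<open>x(i := t)\<close> stays in \<open>U\<close> for \<open>i < d\<close> and \<open>t\<close> near \<open>x i\<close>, so the derivative
  below is the \<open>i\<close>-th partial derivative at \<open>x\<close> and depends only on the values of \<open>f\<close> on \<open>U\<close>.
\<close>

primrec Ck_on :: "nat \<Rightarrow> nat \<Rightarrow> (nat \<Rightarrow> real) set \<Rightarrow> ((nat \<Rightarrow> real) \<Rightarrow> real) \<Rightarrow> bool" where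
  "Ck_on d 0 U f \<longleftrightarrow>
     continuous_map (subtopology (Euclidean_space d) U) euclideanreal f"
| "Ck_on d (Suc k) U f \<longleftrightarrow>
     continuous_map (subtopology (Euclidean_space d) U) euclideanreal f \<and>
     (\<forall>i<d. \<exists>g. (\<forall>x\<in>U. ((\<lambda>t. f (x(i := t))) has_real_derivative g x) (at (x i))) \<and>
                Ck_on d k U g)"

definition smooth_on :: "nat \<Rightarrow> (nat \<Rightarrow> real) set \<Rightarrow> ((nat \<Rightarrow> real) \<Rightarrow> real) \<Rightarrow> bool" where
  "smooth_on d U f \<longleftrightarrow> (\<forall>k. Ck_on d k U f)"


section \<open>Smooth manifolds\<close>

text \<open>
  A chart is a domain with a coordinate map.  An atlas need not be maximal; it determines the
  smooth structure.
\<close>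

type_synonym 'p chart = "'p set \<times> ('p \<Rightarrow> nat \<Rightarrow> real)"

record 'p manifold =
  mdim :: nat
  mtop :: "'p topology"
  atlas :: "'p chart set"

abbreviation points :: "'p manifold \<Rightarrow> 'p set" where
  "points M \<equiv> topspace (mtop M)"

definition is_chart :: "nat \<Rightarrow> 'p topology \<Rightarrow> 'p chart \<Rightarrow> bool" where
  "is_chart d T = (\<lambda>(U, \<psi>).
     openin T U \<and> openin (Euclidean_space d) (\<psi> ` U) \<and>
     homeomorphic_map (subtopology T U) (subtopology (Euclidean_space d) (\<psi> ` U)) \<psi>)"

definition smooth_transition :: "nat \<Rightarrow> 'p chart \<Rightarrow> 'p chart \<Rightarrow> bool" where
  "smooth_transition d = (\<lambda>(U, \<psi>) (V, \<psi>').
     \<forall>i<d. smooth_on d (\<psi> ` (U \<inter> V)) (\<lambda>x. \<psi>' (inv_into U \<psi> x) i))"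

definition smooth_manifold :: "'p manifold \<Rightarrow> bool" where
  "smooth_manifold M \<longleftrightarrow>
     Hausdorff_space (mtop M) \<and> second_countable (mtop M) \<and>
     (\<forall>c\<in>atlas M. is_chart (mdim M) (mtop M) c) \<and>
     (\<Union>c\<in>atlas M. fst c) = points M \<and>
     (\<forall>c\<in>atlas M. \<forall>c'\<in>atlas M. smooth_transition (mdim M) c c')"

definition smooth_map :: "'p manifold \<Rightarrow> 'q manifold \<Rightarrow> ('p \<Rightarrow> 'q) \<Rightarrow> bool" where
  "smooth_map M N f \<longleftrightarrow>
     continuous_map (mtop M) (mtop N) f \<and>
     (\<forall>(U, \<psi>)\<in>atlas M. \<forall>(V, \<psi>')\<in>atlas N. \<forall>j<mdim N.
        smooth_on (mdim M) (\<psi> ` (U \<inter> f -` V)) (\<lambda>x. \<psi>' (f (inv_into U \<psi> x)) j))"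

definition diffeomorphism :: "'p manifold \<Rightarrow> 'q manifold \<Rightarrow> ('p \<Rightarrow> 'q) \<Rightarrow> bool" where
  "diffeomorphism M N f \<longleftrightarrow>
     (\<exists>g. smooth_map M N f \<and> smooth_map N M g \<and>
          (\<forall>x\<in>points M. g (f x) = x) \<and> (\<forall>y\<in>points N. f (g y) = y))"

definition open_submanifold :: "'p manifold \<Rightarrow> 'p set \<Rightarrow> 'p manifold" where
  "open_submanifold M W =
     \<lparr>mdim = mdim M, mtop = subtopology (mtop M) W, atlas = (\<lambda>(U, \<psi>). (U \<inter> W, \<psi>)) ` atlas M\<rparr>"

definition join_coords :: "nat \<Rightarrow> (nat \<Rightarrow> real) \<Rightarrow> (nat \<Rightarrow> real) \<Rightarrow> nat \<Rightarrow> real" where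
  "join_coords d x y = (\<lambda>i. if i < d then x i else y (i - d))"

text \<open>The product manifold of \<open>M\<close> with \<open>Euclidean_space r\<close>.\<close>

definition times_Euclidean :: "'p manifold \<Rightarrow> nat \<Rightarrow> ('p \<times> (nat \<Rightarrow> real)) manifold" where
  "times_Euclidean M r =
     \<lparr>mdim = mdim M + r,
      mtop = prod_topology (mtop M) (Euclidean_space r),
      atlas = (\<lambda>(U, \<psi>). (U \<times> topspace (Euclidean_space r),
                          \<lambda>(p, v). join_coords (mdim M) (\<psi> p) v)) ` atlas M\<rparr>"

text \<open>
  Functions on \<open>M\<close>, sections and vector fields are represented by extensional HOL functions, so that
  equality as HOL functions is equality on \<open>M\<close>.
\<close>

definition smooth_functions :: "'p manifold \<Rightarrow> ('p \<Rightarrow> real) set" where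
  "smooth_functions M =
     {f \<in> extensional (points M).
        \<forall>(U, \<psi>)\<in>atlas M. smooth_on (mdim M) (\<psi> ` U) (\<lambda>x. f (inv_into U \<psi> x))}"

text \<open>Tangent vectors at \<open>p\<close> are the derivations at \<open>p\<close> of the algebra of smooth functions.\<close>

definition tangent_space :: "'p manifold \<Rightarrow> 'p \<Rightarrow> (('p \<Rightarrow> real) \<Rightarrow> real) set" where
  "tangent_space M p =
     {v \<in> extensional (smooth_functions M).
        (\<forall>f\<in>smooth_functions M. \<forall>g\<in>smooth_functions M.
           v (\<lambda>q\<in>points M. f q + g q) = v f + v g \<and>
           v (\<lambda>q\<in>points M. f q * g q) = f p * v g + g p * v f) \<and>
        (\<forall>f\<in>smooth_functions M. \<forall>c::real. v (\<lambda>q\<in>points M. c * f q) = c * v f)}"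

definition apply_field ::
    "'p manifold \<Rightarrow> ('p \<Rightarrow> ('p \<Rightarrow> real) \<Rightarrow> real) \<Rightarrow> ('p \<Rightarrow> real) \<Rightarrow> 'p \<Rightarrow> real" where
  "apply_field M V f = (\<lambda>p\<in>points M. V p f)"

text \<open>
  A field of tangent vectors is smooth, i.e. a smooth section of the tangent bundle, if it maps
  smooth functions to smooth functions.
\<close>

definition vector_fields :: "'p manifold \<Rightarrow> ('p \<Rightarrow> ('p \<Rightarrow> real) \<Rightarrow> real) set" where
  "vector_fields M =
     {V \<in> (\<Pi>\<^sub>E p\<in>points M. tangent_space M p).
        \<forall>f\<in>smooth_functions M. apply_field M V f \<in> smooth_functions M}"


section \<open>Smooth vector bundles and their sections\<close>

definition real_ring :: "real ring" where
  "real_ring = \<lparr>carrier = UNIV, mult = (*), one = 1, zero = 0, add = (+)\<rparr>"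

text \<open>
  \<open>fibre A p\<close> is the vector space over \<open>p\<close>.  HOL-Algebra's module record extends the ring record;
  its multiplicative fields play no role and are left unspecified.
\<close>

record ('m, 'e) bundle_data =
  base :: "'m manifold"
  total_space :: "'e manifold"
  bundle_proj :: "'e \<Rightarrow> 'm"
  bundle_rank :: nat
  fibre :: "'m \<Rightarrow> (real, 'e) module"

definition local_trivialization ::
    "('m, 'e) bundle_data \<Rightarrow> 'm set \<Rightarrow> ('e \<Rightarrow> nat \<Rightarrow> real) \<Rightarrow> bool" where
  "local_trivialization A U \<phi> \<longleftrightarrow>
     openin (mtop (base A)) U \<and>
     diffeomorphism
       (open_submanifold (total_space A) {e \<in> points (total_space A). bundle_proj A e \<in> U})
       (times_Euclidean (open_submanifold (base A) U) (bundle_rank A))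
       (\<lambda>e. (bundle_proj A e, \<phi> e)) \<and>
     (\<forall>p\<in>U. \<forall>e\<in>carrier (fibre A p).
        (\<forall>e'\<in>carrier (fibre A p). \<phi> (e \<oplus>\<^bsub>fibre A p\<^esub> e') = (\<lambda>i. \<phi> e i + \<phi> e' i)) \<and>
        (\<forall>c. \<phi> (c \<odot>\<^bsub>fibre A p\<^esub> e) = (\<lambda>i. c * \<phi> e i)))"

definition vector_bundle :: "('m, 'e) bundle_data \<Rightarrow> bool" where
  "vector_bundle A \<longleftrightarrow>
     smooth_manifold (base A) \<and> smooth_manifold (total_space A) \<and>
     smooth_map (total_space A) (base A) (bundle_proj A) \<and>
     (\<forall>p\<in>points (base A).
        carrier (fibre A p) = {e \<in> points (total_space A). bundle_proj A e = p} \<and>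
        Module.module real_ring (fibre A p) \<and>
        (\<exists>U \<phi>. p \<in> U \<and> local_trivialization A U \<phi>))"

text \<open>The module \<open>\<Gamma>(A)\<close> of smooth sections, with pointwise operations.\<close>

definition sections :: "('m, 'e) bundle_data \<Rightarrow> ('m \<Rightarrow> real, 'm \<Rightarrow> 'e) module" (\<open>\<Gamma>\<close>) where
  "\<Gamma> A =
     \<lparr>carrier = {X \<in> extensional (points (base A)).
                  smooth_map (base A) (total_space A) X \<and> (\<forall>p\<in>points (base A). bundle_proj A (X p) = p)},
      mult = undefined, one = undefined,
      zero = (\<lambda>p\<in>points (base A). \<zero>\<^bsub>fibre A p\<^esub>),
      add = (\<lambda>X Y. \<lambda>p\<in>points (base A). X p \<oplus>\<^bsub>fibre A p\<^esub> Y p),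
      smult = (\<lambda>f X. \<lambda>p\<in>points (base A). f p \<odot>\<^bsub>fibre A p\<^esub> X p)\<rparr>"

definition real_smult :: "('m, 'e) bundle_data \<Rightarrow> real \<Rightarrow> ('m \<Rightarrow> 'e) \<Rightarrow> 'm \<Rightarrow> 'e" where
  "real_smult A c X = (\<lambda>p\<in>points (base A). c) \<odot>\<^bsub>\<Gamma> A\<^esub> X"

text \<open>
  A list of length \<open>m\<close> stands for \<open>X\<^sub>1, \<dots>, X\<^sub>m\<close> (or \<open>X\<^sub>1 \<and> \<dots> \<and> X\<^sub>m\<close>), so that
  \<open>X\<^sub>k\<close> is \<open>Xs ! (k - 1)\<close>.
\<close>

definition section_lists :: "('m, 'e) bundle_data \<Rightarrow> nat \<Rightarrow> ('m \<Rightarrow> 'e) list set" where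
  "section_lists A m = {Xs. length Xs = m \<and> set Xs \<subseteq> carrier (\<Gamma> A)}"

definition omit :: "nat \<Rightarrow> 'a list \<Rightarrow> 'a list" where
  "omit k Xs = take (k - 1) Xs @ drop k Xs"

definition swap :: "nat \<Rightarrow> nat \<Rightarrow> 'a list \<Rightarrow> 'a list" where
  "swap i j Xs = Xs[i := Xs ! j, j := Xs ! i]"


section \<open>Anchors and connections\<close>

text \<open>
  A map out of an exterior power is given by its skew-symmetric multilinear map on factors; this
  convention is used fibrewise for the anchor and on sections for the connection.
  The connection is written \<open>D\<close>: \<open>D [X\<^sub>1, \<dots>, X\<^sub>m] X\<close> is the derivative of \<open>X\<close> along
  \<open>X\<^sub>1 \<and> \<dots> \<and> X\<^sub>m\<close>.
\<close>

definition anchor_on_sections ::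
    "('m, 'e) bundle_data \<Rightarrow> ('m \<Rightarrow> 'e list \<Rightarrow> ('m \<Rightarrow> real) \<Rightarrow> real) \<Rightarrow>
     ('m \<Rightarrow> 'e) list \<Rightarrow> 'm \<Rightarrow> ('m \<Rightarrow> real) \<Rightarrow> real" where
  "anchor_on_sections A \<aa> Xs = (\<lambda>p\<in>points (base A). \<aa> p (map (\<lambda>X. X p) Xs))"

text \<open>
  Fibrewise skew-symmetric multilinear maps to the tangent spaces form a smooth bundle map
  if and only if they take smooth sections to smooth vector fields.
\<close>

definition n_anchor ::
    "nat \<Rightarrow> ('m, 'e) bundle_data \<Rightarrow> ('m \<Rightarrow> 'e list \<Rightarrow> ('m \<Rightarrow> real) \<Rightarrow> real) \<Rightarrow> bool" where
  "n_anchor n A \<aa> \<longleftrightarrow>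
     (\<forall>p\<in>points (base A). \<forall>es. length es = n - 1 \<and> set es \<subseteq> carrier (fibre A p) \<longrightarrow>
        \<aa> p es \<in> tangent_space (base A) p \<and>
        (\<forall>f\<in>smooth_functions (base A).
          (\<forall>i<n - 1. \<forall>e\<in>carrier (fibre A p).
             \<aa> p (es[i := es ! i \<oplus>\<^bsub>fibre A p\<^esub> e]) f = \<aa> p es f + \<aa> p (es[i := e]) f) \<and>
          (\<forall>i<n - 1. \<forall>c. \<aa> p (es[i := c \<odot>\<^bsub>fibre A p\<^esub> (es ! i)]) f = c * \<aa> p es f) \<and>
          (\<forall>i j. i < j \<and> j < n - 1 \<longrightarrow> \<aa> p (swap i j es) f = - \<aa> p es f))) \<and>
     (\<forall>Xs\<in>section_lists A (n - 1). anchor_on_sections A \<aa> Xs \<in> vector_fields (base A))"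

definition n_anchored_bundle ::
    "nat \<Rightarrow> ('m, 'e) bundle_data \<Rightarrow> ('m \<Rightarrow> 'e list \<Rightarrow> ('m \<Rightarrow> real) \<Rightarrow> real) \<Rightarrow> bool" where
  "n_anchored_bundle n A \<aa> \<longleftrightarrow> vector_bundle A \<and> n_anchor n A \<aa>"

definition n_connection ::
    "nat \<Rightarrow> ('m, 'e) bundle_data \<Rightarrow> ('m \<Rightarrow> 'e list \<Rightarrow> ('m \<Rightarrow> real) \<Rightarrow> real) \<Rightarrow>
     (('m \<Rightarrow> 'e) list \<Rightarrow> ('m \<Rightarrow> 'e) \<Rightarrow> 'm \<Rightarrow> 'e) \<Rightarrow> bool" where
  "n_connection n A \<aa> D \<longleftrightarrow>
     (\<forall>Xs\<in>section_lists A (n - 1). \<forall>X\<in>carrier (\<Gamma> A).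
        D Xs X \<in> carrier (\<Gamma> A) \<and>
        (\<forall>i<n - 1. \<forall>Y\<in>carrier (\<Gamma> A).
           D (Xs[i := Xs ! i \<oplus>\<^bsub>\<Gamma> A\<^esub> Y]) X = D Xs X \<oplus>\<^bsub>\<Gamma> A\<^esub> D (Xs[i := Y]) X) \<and>
        (\<forall>i<n - 1. \<forall>c. D (Xs[i := real_smult A c (Xs ! i)]) X = real_smult A c (D Xs X)) \<and>
        (\<forall>Y\<in>carrier (\<Gamma> A). D Xs (X \<oplus>\<^bsub>\<Gamma> A\<^esub> Y) = D Xs X \<oplus>\<^bsub>\<Gamma> A\<^esub> D Xs Y) \<and>
        (\<forall>c. D Xs (real_smult A c X) = real_smult A c (D Xs X)) \<and>
        (\<forall>i j. i < j \<and> j < n - 1 \<longrightarrow> D (swap i j Xs) X = \<ominus>\<^bsub>\<Gamma> A\<^esub> D Xs X) \<and>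
        (\<forall>f\<in>smooth_functions (base A).
           D (Xs[0 := f \<odot>\<^bsub>\<Gamma> A\<^esub> (Xs ! 0)]) X = f \<odot>\<^bsub>\<Gamma> A\<^esub> D Xs X \<and>
           D Xs (f \<odot>\<^bsub>\<Gamma> A\<^esub> X) =
             f \<odot>\<^bsub>\<Gamma> A\<^esub> D Xs X \<oplus>\<^bsub>\<Gamma> A\<^esub>
             apply_field (base A) (anchor_on_sections A \<aa> Xs) f \<odot>\<^bsub>\<Gamma> A\<^esub> X))"


section \<open>Induced bracket and curvature\<close>

definition n_bracket ::
    "nat \<Rightarrow> ('m, 'e) bundle_data \<Rightarrow> (('m \<Rightarrow> 'e) list \<Rightarrow> ('m \<Rightarrow> 'e) \<Rightarrow> 'm \<Rightarrow> 'e) \<Rightarrow>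
     ('m \<Rightarrow> 'e) list \<Rightarrow> 'm \<Rightarrow> 'e" where
  "n_bracket n A D Xs =
     (\<Oplus>\<^bsub>\<Gamma> A\<^esub>k\<in>{1..n}. real_smult A ((-1) ^ (n + k)) (D (omit k Xs) (Xs ! (k - 1))))"

text \<open>
  The bracket of two decomposable \<open>(n - 1)\<close>-vectors is a sum of \<open>n - 1\<close> decomposable ones.  It is
  represented by the list of its summands, and \<open>D\<close> is extended additively to such formal sums.
\<close>

definition wedge_bracket ::
    "nat \<Rightarrow> ('m, 'e) bundle_data \<Rightarrow> (('m \<Rightarrow> 'e) list \<Rightarrow> ('m \<Rightarrow> 'e) \<Rightarrow> 'm \<Rightarrow> 'e) \<Rightarrow>
     ('m \<Rightarrow> 'e) list \<Rightarrow> ('m \<Rightarrow> 'e) list \<Rightarrow> ('m \<Rightarrow> 'e) list list" where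
  "wedge_bracket n A D Xs Ys =
     map (\<lambda>k. Ys[k - 1 := n_bracket n A D (Xs @ [Ys ! (k - 1)])]) [1..<n]"

definition connection_sum ::
    "('m, 'e) bundle_data \<Rightarrow> (('m \<Rightarrow> 'e) list \<Rightarrow> ('m \<Rightarrow> 'e) \<Rightarrow> 'm \<Rightarrow> 'e) \<Rightarrow>
     ('m \<Rightarrow> 'e) list list \<Rightarrow> ('m \<Rightarrow> 'e) \<Rightarrow> 'm \<Rightarrow> 'e" where
  "connection_sum A D Ds Z = (\<Oplus>\<^bsub>\<Gamma> A\<^esub>i\<in>{..<length Ds}. D (Ds ! i) Z)"

definition n_curvature ::
    "nat \<Rightarrow> ('m, 'e) bundle_data \<Rightarrow> (('m \<Rightarrow> 'e) list \<Rightarrow> ('m \<Rightarrow> 'e) \<Rightarrow> 'm \<Rightarrow> 'e) \<Rightarrow>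
     ('m \<Rightarrow> 'e) list \<Rightarrow> ('m \<Rightarrow> 'e) list \<Rightarrow> ('m \<Rightarrow> 'e) \<Rightarrow> 'm \<Rightarrow> 'e" where
  "n_curvature n A D Xs Ys Z =
     D Xs (D Ys Z) \<ominus>\<^bsub>\<Gamma> A\<^esub> D Ys (D Xs Z) \<ominus>\<^bsub>\<Gamma> A\<^esub>
     connection_sum A D (wedge_bracket n A D Xs Ys) Z"

end

theory Submission
  imports Defs
begin

text \<open>
  The theorem holds instance by instance: for fixed \<open>X\<close> and \<open>Y\<close>, the difference of the two sides of the
  fundamental identity equals the left-hand side of the Bianchi identity.  Write
  \<open>b\<^sub>k = [X\<^sub>1, \<dots>, X\<^sub>n\<^sub>-\<^sub>1, Y\<^sub>k]\<close> and expand all outer brackets.  The left-hand side of the fundamental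
  identity consists of \<open>D X [Y\<^sub>1, \<dots>, Y\<^sub>n]\<close>, which gives the terms \<open>D X (D Y Y\<^sub>k)\<close> of the curvatures, and of
  terms in which \<open>[Y\<^sub>1, \<dots>, Y\<^sub>n]\<close> is the last factor of the wedge product; moving it to the front past
  \<open>n - 2\<close> factors gives the second sum of the Bianchi identity.  On the right-hand side, the summand
  belonging to \<open>k\<close> contains one term that differentiates \<open>b\<^sub>k\<close> itself and \<open>n - 1\<close> terms with \<open>b\<^sub>k\<close> as a
  factor.  The former produce the terms \<open>D Y (D X Y\<^sub>k)\<close> of the curvatures and, through the remaining terms
  of \<open>b\<^sub>k\<close>, the double sum.  The latter, collected by the differentiated \<open>Y\<^sub>j\<close> instead of by \<open>k\<close>, are the
  terms with \<open>[X, Y]\<close> of the curvatures.  This is the content of \<open>fundamental_identity_iff_Bianchi\<close>;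
  it rests on the skew-symmetry of \<open>D\<close> and its real linearity in the differentiated section.

  The computation takes place in the abelian group of smooth sections, and the analytic part of the
  proof establishes that there is one (\<open>abelian_group_sections\<close>).  The group laws hold pointwise; the
  point is that sums, multiples and zero are smooth.  In a local trivialization a section is smooth
  exactly if its coordinate functions are, since a section is recovered from its coordinates by the
  inverse of the trivialization (\<open>section_coordinates_smooth\<close>, \<open>smooth_map_if_coordinates_smooth\<close>).
  This rests on the composition of smooth maps (\<open>smooth_map_compose\<close>), hence on a chain rule for
  functions with continuous partial derivatives (\<open>chain_rule_along_curve\<close>, \<open>Ck_on_compose\<close>).
\<close>

section \<open>Differential calculus on open subsets of Euclidean space\<close>

text \<open>
  The topology is a subspace of an infinite product, but membership in an open set is controlled by
  finitely many coordinates, so that the usual boxes form a neighbourhood base.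
\<close>

lemma Euclidean_space_open_box:
  assumes "openin (Euclidean_space d) U" "x \<in> U"
  obtains \<delta> where "\<delta> > 0"
    "\<And>y. \<lbrakk>\<And>i. i < d \<Longrightarrow> \<bar>y i - x i\<bar> < \<delta>; \<And>i. i \<ge> d \<Longrightarrow> y i = 0\<rbrakk> \<Longrightarrow> y \<in> U"
proof -
  obtain T where T: "openin (powertop_real UNIV) T" "U = T \<inter> {x. \<forall>i\<ge>d. x i = 0}"
    using assms(1) by (auto simp: Euclidean_space_def openin_subtopology)
  obtain X where X: "x \<in> (\<Pi>\<^sub>E i\<in>UNIV. X i)" "\<And>i. open (X i)" "(\<Pi>\<^sub>E i\<in>UNIV. X i) \<subseteq> T"
    using product_topology_open_contains_basis[OF T(1), of x] assms(2) T(2) by auto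
  have "\<exists>e>0. ball (x i) e \<subseteq> X i" for i
  proof -
    have "x i \<in> X i" using X(1) by (auto simp: PiE_UNIV_domain)
    then show ?thesis using X(2)[of i] open_contains_ball by blast
  qed
  then obtain e where e: "\<And>i. e i > 0" "\<And>i. ball (x i) (e i) \<subseteq> X i"
    by metis
  define \<delta> where "\<delta> = Min (insert 1 (e ` {..<d}))"
  have \<delta>: "\<delta> > 0" "\<And>i. i < d \<Longrightarrow> \<delta> \<le> e i"
    unfolding \<delta>_def using e(1) by auto
  have "y \<in> U" if y: "\<And>i. i < d \<Longrightarrow> \<bar>y i - x i\<bar> < \<delta>" "\<And>i. i \<ge> d \<Longrightarrow> y i = 0" for y
  proof -
    have "y i \<in> X i" for i
    proof (cases "i < d")
      case True
      then have "y i \<in> ball (x i) (e i)"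
        using y(1)[of i] \<delta>(2)[of i] by (simp add: dist_real_def abs_minus_commute)
      then show ?thesis using e(2) by blast
    next
      case False
      have "x i = 0" using False assms(2) T(2) by auto
      then show ?thesis using False y(2)[of i] X(1) by (simp add: PiE_UNIV_domain Pi_iff) (metis UNIV_I)
    qed
    then show ?thesis using X(3) T(2) y(2) by (auto simp: PiE_UNIV_domain)
  qed
  with \<delta>(1) show ?thesis by (rule that)
qed

lemma open_Euclidean_space_outside:
  assumes "openin (Euclidean_space d) U" "x \<in> U" "i \<ge> d"
  shows "x i = 0"
  using openin_subset[OF assms(1)] assms(2,3) by (auto simp: topspace_Euclidean_space)

lemma continuous_box:
  assumes U: "openin (Euclidean_space d) U" "x \<in> U"
    and f: "continuous_map (subtopology (Euclidean_space d) U) euclideanreal f" and "e > 0"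
  obtains \<delta> where "\<delta> > 0"
    "\<And>y. \<lbrakk>\<And>i. i < d \<Longrightarrow> \<bar>y i - x i\<bar> < \<delta>; \<And>i. i \<ge> d \<Longrightarrow> y i = 0\<rbrakk> \<Longrightarrow> y \<in> U \<and> \<bar>f y - f x\<bar> < e"
proof -
  let ?V = "{y \<in> topspace (subtopology (Euclidean_space d) U). f y \<in> ball (f x) e}"
  have "openin (subtopology (Euclidean_space d) U) ?V"
    using f by (rule openin_continuous_map_preimage) simp
  then have "openin (Euclidean_space d) ?V"
    using U(1) openin_trans_full by blast
  moreover have "x \<in> ?V"
    using U openin_subset[OF U(1)] \<open>e > 0\<close> by auto
  ultimately obtain \<delta> where "\<delta> > 0"
    "\<And>y. \<lbrakk>\<And>i. i < d \<Longrightarrow> \<bar>y i - x i\<bar> < \<delta>; \<And>i. i \<ge> d \<Longrightarrow> y i = 0\<rbrakk> \<Longrightarrow> y \<in> ?V"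
    by (rule Euclidean_space_open_box) blast
  then show ?thesis
    by (intro that[of \<delta>]) (auto simp: dist_real_def abs_minus_commute)
qed

text \<open>
  Continuous partial derivatives imply differentiability: \<open>x\<close> is changed into \<open>y\<close> one coordinate at a
  time, and the mean value theorem is applied in each step.
\<close>

lemma partial_derivatives_linear_approximation:
  assumes U: "openin (Euclidean_space d) U" "x \<in> U"
    and f: "\<And>i y. \<lbrakk>i < d; y \<in> U\<rbrakk> \<Longrightarrow> ((\<lambda>t. f (y(i := t))) has_real_derivative g i y) (at (y i))"
    and g: "\<And>i. i < d \<Longrightarrow> continuous_map (subtopology (Euclidean_space d) U) euclideanreal (g i)"
    and "e > 0"
  obtains \<delta> where "\<delta> > 0"
    "\<And>y. \<lbrakk>\<And>i. i < d \<Longrightarrow> \<bar>y i - x i\<bar> < \<delta>; \<And>i. i \<ge> d \<Longrightarrow> y i = 0\<rbrakk> \<Longrightarrow>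
       y \<in> U \<and> \<bar>f y - f x - (\<Sum>i<d. g i x * (y i - x i))\<bar> \<le> e * (\<Sum>i<d. \<bar>y i - x i\<bar>)"
proof -
  obtain \<delta>0 where \<delta>0: "\<delta>0 > 0"
    "\<And>y. \<lbrakk>\<And>i. i < d \<Longrightarrow> \<bar>y i - x i\<bar> < \<delta>0; \<And>i. i \<ge> d \<Longrightarrow> y i = 0\<rbrakk> \<Longrightarrow> y \<in> U"
    using Euclidean_space_open_box[OF U] by blast
  have "\<exists>\<delta>>0. \<forall>y. (\<forall>i<d. \<bar>y i - x i\<bar> < \<delta>) \<and> (\<forall>i\<ge>d. y i = 0) \<longrightarrow> \<bar>g j y - g j x\<bar> < e" if "j < d" for j
    using continuous_box[OF U g[OF that] \<open>e > 0\<close>] by metis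
  then obtain D where D: "\<And>j. j < d \<Longrightarrow> D j > 0"
    "\<And>j y. \<lbrakk>j < d; \<And>i. i < d \<Longrightarrow> \<bar>y i - x i\<bar> < D j; \<And>i. i \<ge> d \<Longrightarrow> y i = 0\<rbrakk> \<Longrightarrow> \<bar>g j y - g j x\<bar> < e"
    by metis
  define \<delta> where "\<delta> = Min (insert \<delta>0 (D ` {..<d}))"
  have \<delta>: "\<delta> > 0" "\<delta> \<le> \<delta>0" "\<And>i. i < d \<Longrightarrow> \<delta> \<le> D i"
    unfolding \<delta>_def using D(1) \<delta>0(1) by auto
  have x0: "x i = 0" if "i \<ge> d" for i
    using open_Euclidean_space_outside[OF U that] .
  have "y \<in> U \<and> \<bar>f y - f x - (\<Sum>i<d. g i x * (y i - x i))\<bar> \<le> e * (\<Sum>i<d. \<bar>y i - x i\<bar>)"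
    if y: "\<And>i. i < d \<Longrightarrow> \<bar>y i - x i\<bar> < \<delta>" "\<And>i. i \<ge> d \<Longrightarrow> y i = 0" for y
  proof
    show "y \<in> U"
      using y \<delta>(2) by (intro \<delta>0(2)) force+
    define z where "z k = (\<lambda>i. if i < k then y i else x i)" for k :: nat
    have "\<bar>f (z k) - f x - (\<Sum>i<k. g i x * (y i - x i))\<bar> \<le> e * (\<Sum>i<k. \<bar>y i - x i\<bar>)" if "k \<le> d" for k
      using that
    proof (induction k)
      case 0
      then show ?case by (simp add: z_def)
    next
      case (Suc k)
      then have k: "k < d" by simp
      \<comment> \<open>Subtracting the linear term turns the mean value theorem into a bound by \<open>e\<close>.\<close>
      let ?F = "\<lambda>t. f ((z k)(k := t)) - g k x * t"
      let ?S = "closed_segment (x k) (y k)"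
      have box: "\<bar>((z k)(k := t)) i - x i\<bar> < \<delta>" if "t \<in> ?S" "i < d" for t i
        using y(1)[OF that(2)] \<delta>(1) that(1) y(1)[OF k] 
        by (auto simp: z_def closed_segment_eq_real_ivl split: if_splits)
      have outside: "((z k)(k := t)) i = 0" if "i \<ge> d" for t i
        using that k x0 by (simp add: z_def)
      have "norm (?F (y k) - ?F (x k)) \<le> e * norm (y k - x k)"
      proof (rule field_differentiable_bound[where S = ?S])
        fix t assume t: "t \<in> ?S"
        have mem: "(z k)(k := t) \<in> U"
          using box[OF t] outside \<delta>(2) by (intro \<delta>0(2)) force+
        have "((\<lambda>u. f (((z k)(k := t))(k := u))) has_real_derivative g k ((z k)(k := t))) (at t)"
          using f[OF k mem] by simp
        then have "((\<lambda>u. f ((z k)(k := u))) has_real_derivative g k ((z k)(k := t))) (at t within ?S)"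
          by (simp add: has_field_derivative_at_within)
        then show "(?F has_field_derivative (g k ((z k)(k := t)) - g k x)) (at t within ?S)"
          by (auto intro!: derivative_eq_intros)
        show "norm (g k ((z k)(k := t)) - g k x) \<le> e"
          using D(2)[OF k, of "(z k)(k := t)"] box[OF t] \<delta>(3)[OF k] outside by force
      qed auto
      moreover have "(z k)(k := y k) = z (Suc k)" "(z k)(k := x k) = z k"
        by (auto simp: z_def fun_eq_iff less_Suc_eq)
      ultimately have "\<bar>f (z (Suc k)) - f (z k) - g k x * (y k - x k)\<bar> \<le> e * \<bar>y k - x k\<bar>"
        by (simp add: algebra_simps)
      with Suc.IH k show ?case
        by (simp add: distrib_left abs_le_iff)
    qed
    from this[of d] show "\<bar>f y - f x - (\<Sum>i<d. g i x * (y i - x i))\<bar> \<le> e * (\<Sum>i<d. \<bar>y i - x i\<bar>)"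
    proof -
      have "z d = y" using x0 y(2) by (auto simp: z_def fun_eq_iff)
      then show ?thesis using \<open>\<And>k. k \<le> d \<Longrightarrow> _\<close>[of d] by simp
    qed
  qed
  with \<delta>(1) show ?thesis by (rule that)
qed

text \<open>
  The error of the linear approximation is at most \<open>e\<close> times the distance from \<open>\<gamma> t\<close>, and the difference
  quotients of \<open>\<gamma>\<close> at \<open>t\<close> stay bounded, so the error contributes nothing to the derivative.
\<close>

lemma chain_rule_along_curve:
  assumes U: "openin (Euclidean_space d) U" "\<gamma> t \<in> U"
    and f: "\<And>i y. \<lbrakk>i < d; y \<in> U\<rbrakk> \<Longrightarrow> ((\<lambda>t. f (y(i := t))) has_real_derivative g i y) (at (y i))"
    and g: "\<And>i. i < d \<Longrightarrow> continuous_map (subtopology (Euclidean_space d) U) euclideanreal (g i)"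
    and \<gamma>: "\<And>i. i < d \<Longrightarrow> ((\<lambda>t. \<gamma> t i) has_real_derivative c i) (at t)"
    and \<gamma>0: "\<forall>\<^sub>F s in at t. \<forall>i\<ge>d. \<gamma> s i = 0"
  shows "((\<lambda>t. f (\<gamma> t)) has_real_derivative (\<Sum>i<d. g i (\<gamma> t) * c i)) (at t)"
proof -
  let ?x = "\<gamma> t"
  define Q where "Q i s = (\<gamma> s i - ?x i) / (s - t)" for i s
  have Q: "(Q i \<longlongrightarrow> c i) (at t)" if "i < d" for i
    using \<gamma>[OF that] unfolding Q_def has_field_derivative_iff .
  define R where "R s = (f (\<gamma> s) - f ?x) / (s - t) - (\<Sum>i<d. g i ?x * Q i s)" for s
  define C where "C = (\<Sum>i<d. \<bar>c i\<bar>) + 1"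
  have "C > 0" unfolding C_def by (simp add: add_nonneg_pos sum_nonneg)
  have "((\<lambda>s. \<Sum>i<d. \<bar>Q i s\<bar>) \<longlongrightarrow> (\<Sum>i<d. \<bar>c i\<bar>)) (at t)"
    by (intro tendsto_intros Q) auto
  then have C: "\<forall>\<^sub>F s in at t. (\<Sum>i<d. \<bar>Q i s\<bar>) < C"
    by (rule order_tendstoD(2)) (simp add: C_def)
  have "(R \<longlongrightarrow> 0) (at t)"
  proof (rule tendstoI)
    fix e :: real assume "e > 0"
    define e' where "e' = e / C"
    have e': "e' > 0" "e' * C = e" using \<open>e > 0\<close> \<open>C > 0\<close> by (auto simp: e'_def)
    obtain \<delta> where \<delta>: "\<delta> > 0"
      "\<And>y. \<lbrakk>\<And>i. i < d \<Longrightarrow> \<bar>y i - ?x i\<bar> < \<delta>; \<And>i. i \<ge> d \<Longrightarrow> y i = 0\<rbrakk> \<Longrightarrow>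
         y \<in> U \<and> \<bar>f y - f ?x - (\<Sum>i<d. g i ?x * (y i - ?x i))\<bar> \<le> e' * (\<Sum>i<d. \<bar>y i - ?x i\<bar>)"
      using partial_derivatives_linear_approximation[OF U f g e'(1)] by blast
    have near: "\<forall>\<^sub>F s in at t. \<forall>i\<in>{..<d}. \<bar>\<gamma> s i - ?x i\<bar> < \<delta>"
    proof (rule eventually_ball_finite)
      show "\<forall>i\<in>{..<d}. \<forall>\<^sub>F s in at t. \<bar>\<gamma> s i - ?x i\<bar> < \<delta>"
      proof
        fix i assume "i \<in> {..<d}"
        then have "isCont (\<lambda>s. \<gamma> s i) t"
          using \<gamma> DERIV_isCont by blast
        then have "((\<lambda>s. \<gamma> s i) \<longlongrightarrow> ?x i) (at t)"
          by (simp add: isCont_def)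
        from tendstoD[OF this \<delta>(1)] show "\<forall>\<^sub>F s in at t. \<bar>\<gamma> s i - ?x i\<bar> < \<delta>"
          by (simp add: dist_real_def)
      qed
    qed simp
    have "\<forall>\<^sub>F s in at t. s \<noteq> t" by (simp add: eventually_at_filter)
    with near \<gamma>0 C show "\<forall>\<^sub>F s in at t. dist (R s) 0 < e"
    proof eventually_elim
      fix s assume s: "\<forall>i\<in>{..<d}. \<bar>\<gamma> s i - ?x i\<bar> < \<delta>" "\<forall>i\<ge>d. \<gamma> s i = 0"
        "(\<Sum>i<d. \<bar>Q i s\<bar>) < C" "s \<noteq> t"
      have "R s = (f (\<gamma> s) - f ?x - (\<Sum>i<d. g i ?x * (\<gamma> s i - ?x i))) / (s - t)"
        unfolding R_def Q_def by (simp add: diff_divide_distrib[of _ "sum _ _"] sum_divide_distrib)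
      then have "\<bar>R s\<bar> \<le> e' * (\<Sum>i<d. \<bar>\<gamma> s i - ?x i\<bar>) / \<bar>s - t\<bar>"
        using \<delta>(2)[of "\<gamma> s"] s by (simp add: abs_divide divide_right_mono)
      also have "\<dots> = e' * (\<Sum>i<d. \<bar>Q i s\<bar>)"
        unfolding Q_def by (simp only: abs_divide sum_divide_distrib[symmetric] times_divide_eq_right)
      also have "\<dots> < e' * C"
        using s(3) e'(1) by simp
      finally show "dist (R s) 0 < e" by (simp add: dist_real_def e')
    qed
  qed
  moreover have "((\<lambda>s. \<Sum>i<d. g i ?x * Q i s) \<longlongrightarrow> (\<Sum>i<d. g i ?x * c i)) (at t)"
    by (intro tendsto_intros Q) auto
  ultimately have "((\<lambda>s. R s + (\<Sum>i<d. g i ?x * Q i s)) \<longlongrightarrow> 0 + (\<Sum>i<d. g i ?x * c i)) (at t)"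
    by (rule tendsto_add)
  then show ?thesis
    unfolding has_field_derivative_iff by (simp add: R_def)
qed

lemma eventually_line_in_open:
  assumes U: "openin (Euclidean_space d) U" "x \<in> U" and "i < d"
  shows "\<forall>\<^sub>F t in nhds (x i). x(i := t) \<in> U"
proof -
  obtain \<delta> where \<delta>: "\<delta> > 0"
    "\<And>y. \<lbrakk>\<And>i. i < d \<Longrightarrow> \<bar>y i - x i\<bar> < \<delta>; \<And>i. i \<ge> d \<Longrightarrow> y i = 0\<rbrakk> \<Longrightarrow> y \<in> U"
    using Euclidean_space_open_box[OF U] by blast
  have "x(i := t) \<in> U" if "dist t (x i) < \<delta>" for t
    using that \<delta>(1) \<open>i < d\<close> open_Euclidean_space_outside[OF U]
    by (intro \<delta>(2)) (auto simp: dist_real_def)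
  with \<delta>(1) show ?thesis by (auto simp: eventually_nhds_metric)
qed

lemma partial_derivative_cong:
  assumes U: "openin (Euclidean_space d) U" "x \<in> U" and "i < d"
    and eq: "\<And>y. y \<in> U \<Longrightarrow> f y = f' y"
  shows "((\<lambda>t. f (x(i := t))) has_real_derivative D) (at (x i)) \<longleftrightarrow>
         ((\<lambda>t. f' (x(i := t))) has_real_derivative D) (at (x i))"
  using eventually_mono[OF eventually_line_in_open[OF assms(1-3)] eq]
  by (intro DERIV_cong_ev) auto

lemma Ck_on_Suc_obtain_partial:
  assumes "Ck_on d (Suc k) U f" "i < d"
  obtains g where "\<forall>x\<in>U. ((\<lambda>t. f (x(i := t))) has_real_derivative g x) (at (x i))" "Ck_on d k U g"
proof -
  have "\<exists>g. (\<forall>x\<in>U. ((\<lambda>t. f (x(i := t))) has_real_derivative g x) (at (x i))) \<and> Ck_on d k U g"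
    using assms by simp
  then show ?thesis by (elim exE conjE) (rule that)
qed

text \<open>
  For open \<open>U\<close> the partial derivatives depend only on the values on \<open>U\<close>.  On arbitrary sets this fails,
  which is why openness of coordinate domains is checked throughout.
\<close>

lemma Ck_on_cong:
  assumes "openin (Euclidean_space d) U" "\<And>y. y \<in> U \<Longrightarrow> f y = f' y" "Ck_on d k U f"
  shows "Ck_on d k U f'"
  using assms(2,3)
proof (cases k)
  case 0
  then show ?thesis using assms(2,3) by (auto elim: continuous_map_eq)
next
  case (Suc k')
  have "continuous_map (subtopology (Euclidean_space d) U) euclideanreal f'"
    using assms(2,3) Suc by (auto elim: continuous_map_eq)
  moreover have "\<exists>g. (\<forall>x\<in>U. ((\<lambda>t. f' (x(i := t))) has_real_derivative g x) (at (x i))) \<and> Ck_on d k' U g"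
    if "i < d" for i
  proof -
    obtain g where g: "\<forall>x\<in>U. ((\<lambda>t. f (x(i := t))) has_real_derivative g x) (at (x i))" "Ck_on d k' U g"
      using Ck_on_Suc_obtain_partial assms(3) Suc \<open>i < d\<close> by blast
    have "((\<lambda>t. f' (x(i := t))) has_real_derivative g x) (at (x i))" if "x \<in> U" for x
      using partial_derivative_cong[where f = f and f' = f', OF assms(1) that \<open>i < d\<close> assms(2)] g(1) that
      by blast
    with g(2) show ?thesis by blast
  qed
  ultimately show ?thesis using Suc by simp
qed

lemma Ck_on_subset:
  assumes "Ck_on d k U f" "V \<subseteq> U"
  shows "Ck_on d k V f"
  using assms(1)
proof (induction k arbitrary: f)
  case 0
  then show ?case using assms(2) continuous_map_from_subtopology_mono by auto
next
  case (Suc k)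
  have "continuous_map (subtopology (Euclidean_space d) V) euclideanreal f"
    using Suc.prems assms(2) continuous_map_from_subtopology_mono by auto
  with Suc assms(2) show ?case by (fastforce)
qed

lemma Ck_on_imp_continuous:
  "Ck_on d k U f \<Longrightarrow> continuous_map (subtopology (Euclidean_space d) U) euclideanreal f"
  by (cases k) auto

lemma Ck_on_Suc_imp_Ck_on: "Ck_on d (Suc k) U f \<Longrightarrow> Ck_on d k U f"
proof (induction k arbitrary: f)
  case (Suc k)
  then show ?case by (metis Ck_on.simps(2))
qed simp

text \<open>
  Partial derivatives found on the members of an open cover agree on overlaps, because derivatives are
  unique; choosing the derivative at each point therefore glues them.
\<close>

lemma Ck_on_local:
  assumes "\<And>x. x \<in> U \<Longrightarrow> \<exists>V. x \<in> V \<and> V \<subseteq> U \<and> openin (Euclidean_space d) V \<and> Ck_on d k V f"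
  shows "Ck_on d k U f"
  using assms
proof (induction k arbitrary: f)
  case 0
  let ?I = "{V. V \<subseteq> U \<and> openin (Euclidean_space d) V \<and> Ck_on d 0 V f}"
  have "continuous_map (subtopology (Euclidean_space d) U) euclideanreal f"
  proof (rule pasting_lemma[where I = ?I and T = "\<lambda>V. V" and f = "\<lambda>_. f"])
    fix V assume "V \<in> ?I"
    then show "openin (subtopology (Euclidean_space d) U) V"
      by (auto simp: openin_subtopology)
    show "continuous_map (subtopology (subtopology (Euclidean_space d) U) V) euclideanreal f"
      using \<open>V \<in> ?I\<close> by (auto simp: subtopology_subtopology inf.absorb2)
  qed (use 0 in auto)
  then show ?case by simp
next
  case (Suc k)
  have "Ck_on d k U f"
    by (rule Suc.IH) (meson Suc.prems Ck_on_Suc_imp_Ck_on)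
  then have cont: "continuous_map (subtopology (Euclidean_space d) U) euclideanreal f"
    by (rule Ck_on_imp_continuous)
  have "\<exists>g. (\<forall>x\<in>U. ((\<lambda>t. f (x(i := t))) has_real_derivative g x) (at (x i))) \<and> Ck_on d k U g"
    if "i < d" for i
  proof -
    define g where "g x = (SOME D. ((\<lambda>t. f (x(i := t))) has_real_derivative D) (at (x i)))" for x
    have g: "g x = D" if "((\<lambda>t. f (x(i := t))) has_real_derivative D) (at (x i))" for x D
      unfolding g_def using that by (blast intro: DERIV_unique)
    have loc: "\<exists>V. x \<in> V \<and> V \<subseteq> U \<and> openin (Euclidean_space d) V \<and>
        (\<forall>x\<in>V. ((\<lambda>t. f (x(i := t))) has_real_derivative g x) (at (x i))) \<and> Ck_on d k V g"
      if "x \<in> U" for x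
    proof -
      obtain V h where V: "x \<in> V" "V \<subseteq> U" "openin (Euclidean_space d) V"
        "\<forall>x\<in>V. ((\<lambda>t. f (x(i := t))) has_real_derivative h x) (at (x i))" "Ck_on d k V h"
        using Suc.prems[OF \<open>x \<in> U\<close>] \<open>i < d\<close> by auto
      have gh: "g y = h y" if "y \<in> V" for y
        by (rule g) (use V(4) that in blast)
      have "\<forall>y\<in>V. ((\<lambda>t. f (y(i := t))) has_real_derivative g y) (at (y i))"
        using V(4) gh by simp
      moreover have "Ck_on d k V g"
        by (rule Ck_on_cong[OF V(3) _ V(5)]) (simp add: gh)
      ultimately show ?thesis using V(1-3) by blast
    qed
    then show ?thesis using Suc.IH[of g] by blast
  qed
  with cont show ?case by simp
qed

lemma Ck_on_const: "Ck_on d k U (\<lambda>_. c)"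
proof (induction k arbitrary: c)
  case (Suc k)
  have "\<forall>i<d. \<exists>g. (\<forall>x\<in>U. ((\<lambda>t. c) has_real_derivative g x) (at (x i))) \<and> Ck_on d k U g"
    using Suc.IH[of 0] by (auto intro!: exI[of _ "\<lambda>_. 0"])
  then show ?case by simp
qed simp

lemma Ck_on_add:
  assumes "Ck_on d k U f" "Ck_on d k U f'"
  shows "Ck_on d k U (\<lambda>x. f x + f' x)"
  using assms
proof (induction k arbitrary: f f')
  case 0
  then show ?case by (simp add: continuous_map_add)
next
  case (Suc k)
  have "\<exists>g. (\<forall>x\<in>U. ((\<lambda>t. f (x(i := t)) + f' (x(i := t))) has_real_derivative g x) (at (x i))) \<and> Ck_on d k U g"
    if "i < d" for i
  proof -
    obtain g where g: "\<forall>x\<in>U. ((\<lambda>t. f (x(i := t))) has_real_derivative g x) (at (x i))" "Ck_on d k U g"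
      using Ck_on_Suc_obtain_partial[OF Suc.prems(1) \<open>i < d\<close>] .
    obtain g' where g': "\<forall>x\<in>U. ((\<lambda>t. f' (x(i := t))) has_real_derivative g' x) (at (x i))" "Ck_on d k U g'"
      using Ck_on_Suc_obtain_partial[OF Suc.prems(2) \<open>i < d\<close>] .
    show ?thesis
      using g g' Suc.IH by (intro exI[of _ "\<lambda>x. g x + g' x"]) (auto intro!: DERIV_add)
  qed
  then show ?case using Suc.prems by (simp add: continuous_map_add)
qed

lemma Ck_on_mult:
  assumes "Ck_on d k U f" "Ck_on d k U f'"
  shows "Ck_on d k U (\<lambda>x. f x * f' x)"
  using assms
proof (induction k arbitrary: f f')
  case 0
  then show ?case by (simp add: continuous_map_real_mult)
next
  case (Suc k)
  have "\<exists>g. (\<forall>x\<in>U. ((\<lambda>t. f (x(i := t)) * f' (x(i := t))) has_real_derivative g x) (at (x i))) \<and> Ck_on d k U g"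
    if "i < d" for i
  proof -
    obtain g where g: "\<forall>x\<in>U. ((\<lambda>t. f (x(i := t))) has_real_derivative g x) (at (x i))" "Ck_on d k U g"
      using Ck_on_Suc_obtain_partial[OF Suc.prems(1) \<open>i < d\<close>] .
    obtain g' where g': "\<forall>x\<in>U. ((\<lambda>t. f' (x(i := t))) has_real_derivative g' x) (at (x i))" "Ck_on d k U g'"
      using Ck_on_Suc_obtain_partial[OF Suc.prems(2) \<open>i < d\<close>] .
    have "Ck_on d k U f" "Ck_on d k U f'"
      using Suc.prems Ck_on_Suc_imp_Ck_on by blast+
    then have "Ck_on d k U (\<lambda>x. g x * f' x + f x * g' x)"
      using g g' Suc.IH by (intro Ck_on_add) auto
    moreover have "((\<lambda>t. f (x(i := t)) * f' (x(i := t))) has_real_derivative g x * f' x + f x * g' x) (at (x i))"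
      if "x \<in> U" for x
    proof -
      have "((\<lambda>t. f (x(i := t))) has_real_derivative g x) (at (x i))"
           "((\<lambda>t. f' (x(i := t))) has_real_derivative g' x) (at (x i))"
        using g g' that by auto
      from DERIV_mult[OF this] show ?thesis by (simp add: mult.commute add.commute)
    qed
    ultimately show ?thesis by (intro exI[of _ "\<lambda>x. g x * f' x + f x * g' x"]) auto
  qed
  then show ?case using Suc.prems by (simp add: continuous_map_real_mult)
qed

lemma Ck_on_sum:
  assumes "finite I" "\<And>i. i \<in> I \<Longrightarrow> Ck_on d k U (f i)"
  shows "Ck_on d k U (\<lambda>x. \<Sum>i\<in>I. f i x)"
  using assms by (induction I rule: finite_induct) (auto intro: Ck_on_const Ck_on_add)

lemma continuous_map_Euclidean_space_iff_components:
  "continuous_map X (Euclidean_space n) f \<longleftrightarrow>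
     (\<forall>i<n. continuous_map X euclideanreal (\<lambda>x. f x i)) \<and> (\<forall>x\<in>topspace X. \<forall>i\<ge>n. f x i = 0)"
  (is "?L \<longleftrightarrow> ?C \<and> ?Z")
proof
  assume ?L
  then show "?C \<and> ?Z"
    by (auto simp: Euclidean_space_def continuous_map_in_subtopology continuous_map_componentwise_UNIV)
next
  assume R: "?C \<and> ?Z"
  then have "continuous_map X (Euclidean_space n) (\<lambda>x i. if i < n then f x i else 0)"
    by (simp add: continuous_map_componentwise_Euclidean_space)
  then show ?L
    by (rule continuous_map_eq) (use R in \<open>auto simp: fun_eq_iff\<close>)
qed

text \<open>
  By the chain rule along coordinate lines, the partial derivatives of the composition are sums of
  products of functions to which the induction hypothesis applies.
\<close>

lemma Ck_on_compose:
  assumes U: "openin (Euclidean_space d) U" and V: "openin (Euclidean_space m) V"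
    and \<gamma>: "\<And>j. j < m \<Longrightarrow> Ck_on d k U (\<lambda>x. \<gamma> x j)" "\<And>x. x \<in> U \<Longrightarrow> \<gamma> x \<in> V"
    and h: "Ck_on m k V h"
  shows "Ck_on d k U (\<lambda>x. h (\<gamma> x))"
  using \<gamma>(1) h
proof (induction k arbitrary: h)
  case 0
  have "continuous_map (subtopology (Euclidean_space d) U) (subtopology (Euclidean_space m) V) \<gamma>"
    using 0(1) \<gamma>(2) open_Euclidean_space_outside[OF V]
    by (auto simp: continuous_map_in_subtopology continuous_map_Euclidean_space_iff_components)
  then show ?case
    using continuous_map_compose[OF _ 0(2)[simplified]] by (simp add: o_def)
next
  case (Suc k)
  have \<gamma>k: "Ck_on d k U (\<lambda>x. \<gamma> x j)" if "j < m" for j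
    using Suc.prems(1)[OF that] by (rule Ck_on_Suc_imp_Ck_on)
  have IH: "Ck_on d k U (\<lambda>x. g (\<gamma> x))" if "Ck_on m k V g" for g
    by (rule Suc.IH[OF \<gamma>k that])
  obtain g where g: "\<And>j y. \<lbrakk>j < m; y \<in> V\<rbrakk> \<Longrightarrow> ((\<lambda>t. h (y(j := t))) has_real_derivative g j y) (at (y j))"
    "\<And>j. j < m \<Longrightarrow> Ck_on m k V (g j)"
    using Suc.prems(2) by simp metis
  have "\<exists>G. (\<forall>x\<in>U. ((\<lambda>t. h (\<gamma> (x(i := t)))) has_real_derivative G x) (at (x i))) \<and> Ck_on d k U G"
    if "i < d" for i
  proof -
    have "\<forall>j<m. \<exists>c. (\<forall>x\<in>U. ((\<lambda>t. \<gamma> (x(i := t)) j) has_real_derivative c x) (at (x i))) \<and> Ck_on d k U c"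
      using Suc.prems(1) that by simp
    then obtain c where c: "\<And>j x. \<lbrakk>j < m; x \<in> U\<rbrakk> \<Longrightarrow> ((\<lambda>t. \<gamma> (x(i := t)) j) has_real_derivative c j x) (at (x i))"
      "\<And>j. j < m \<Longrightarrow> Ck_on d k U (c j)"
      by metis
    have "Ck_on d k U (\<lambda>x. \<Sum>j<m. g j (\<gamma> x) * c j x)"
      by (intro Ck_on_sum Ck_on_mult IH g(2) c(2)) auto
    moreover have "((\<lambda>t. h (\<gamma> (x(i := t)))) has_real_derivative (\<Sum>j<m. g j (\<gamma> x) * c j x)) (at (x i))"
      if x: "x \<in> U" for x
    proof -
      have ev: "\<forall>\<^sub>F t in at (x i). \<forall>j\<ge>m. \<gamma> (x(i := t)) j = 0"
        using eventually_line_in_open[OF U x \<open>i < d\<close>]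
        by (auto simp: eventually_at_filter elim!: eventually_mono
              intro!: open_Euclidean_space_outside[OF V] \<gamma>(2))
      have "((\<lambda>t. h (\<gamma> (x(i := t)))) has_real_derivative
              (\<Sum>j<m. g j (\<gamma> (x(i := x i))) * c j x)) (at (x i))"
      proof (rule chain_rule_along_curve[where \<gamma> = "\<lambda>t. \<gamma> (x(i := t))", OF V])
        show "((\<lambda>t. h (y(j := t))) has_real_derivative g j y) (at (y j))" if "j < m" "y \<in> V" for j y
          using g(1) that .
        show "continuous_map (subtopology (Euclidean_space m) V) euclideanreal (g j)" if "j < m" for j
          using g(2)[OF that] by (rule Ck_on_imp_continuous)
      qed (use x \<gamma>(2) c(1) ev in auto)
      then show ?thesis by simp
    qed
    ultimately show ?thesis by (intro exI[of _ "\<lambda>x. \<Sum>j<m. g j (\<gamma> x) * c j x"]) auto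
  qed
  moreover have "continuous_map (subtopology (Euclidean_space d) U) euclideanreal (\<lambda>x. h (\<gamma> x))"
    using IH[OF Ck_on_Suc_imp_Ck_on[OF Suc.prems(2)]] by (rule Ck_on_imp_continuous)
  ultimately show ?case by simp
qed

lemma smooth_on_compose:
  assumes "openin (Euclidean_space d) U" "openin (Euclidean_space m) V"
    and "\<And>j. j < m \<Longrightarrow> smooth_on d U (\<lambda>x. \<gamma> x j)" "\<And>x. x \<in> U \<Longrightarrow> \<gamma> x \<in> V" "smooth_on m V h"
  shows "smooth_on d U (\<lambda>x. h (\<gamma> x))"
  using assms Ck_on_compose[OF assms(1,2)] by (auto simp: smooth_on_def)

lemma smooth_on_cong:
  assumes "openin (Euclidean_space d) U" "\<And>y. y \<in> U \<Longrightarrow> f y = f' y" "smooth_on d U f"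
  shows "smooth_on d U f'"
  using assms Ck_on_cong[OF assms(1,2)] by (auto simp: smooth_on_def)

lemma smooth_on_subset: "\<lbrakk>smooth_on d U f; V \<subseteq> U\<rbrakk> \<Longrightarrow> smooth_on d V f"
  unfolding smooth_on_def by (blast intro: Ck_on_subset)

lemma smooth_on_local:
  assumes "\<And>x. x \<in> U \<Longrightarrow> \<exists>V. x \<in> V \<and> V \<subseteq> U \<and> openin (Euclidean_space d) V \<and> smooth_on d V f"
  shows "smooth_on d U f"
  unfolding smooth_on_def
proof
  fix k show "Ck_on d k U f"
  proof (rule Ck_on_local)
    fix x assume "x \<in> U"
    then obtain V where "x \<in> V" "V \<subseteq> U" "openin (Euclidean_space d) V" "smooth_on d V f"
      using assms by blast
    then show "\<exists>V. x \<in> V \<and> V \<subseteq> U \<and> openin (Euclidean_space d) V \<and> Ck_on d k V f"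
      unfolding smooth_on_def by blast
  qed
qed

lemma smooth_on_add: "\<lbrakk>smooth_on d U f; smooth_on d U g\<rbrakk> \<Longrightarrow> smooth_on d U (\<lambda>x. f x + g x)"
  by (simp add: smooth_on_def Ck_on_add)

lemma smooth_on_cmult: "smooth_on d U f \<Longrightarrow> smooth_on d U (\<lambda>x. c * f x)"
  by (simp add: smooth_on_def Ck_on_mult Ck_on_const)


section \<open>Smooth maps between manifolds\<close>

text \<open>
  The common setting for composing smooth maps.  It is passed on easily to the manifolds built from
  others that occur below, in particular to the product with Euclidean space, the target of a local
  trivialization.
\<close>

definition charted :: "'p manifold \<Rightarrow> bool" where
  "charted M \<longleftrightarrow> (\<forall>c\<in>atlas M. is_chart (mdim M) (mtop M) c) \<and> (\<Union>c\<in>atlas M. fst c) = points M"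

lemma smooth_manifold_imp_charted: "smooth_manifold M \<Longrightarrow> charted M"
  by (simp add: smooth_manifold_def charted_def)

lemma smooth_manifold_transition:
  assumes "smooth_manifold M" "(U, \<psi>) \<in> atlas M" "(V, \<psi>') \<in> atlas M" "i < mdim M"
  shows "smooth_on (mdim M) (\<psi> ` (U \<inter> V)) (\<lambda>x. \<psi>' (inv_into U \<psi> x) i)"
proof -
  have "smooth_transition (mdim M) (U, \<psi>) (V, \<psi>')"
    using assms(1-3) unfolding smooth_manifold_def by blast
  then show ?thesis using assms(4) by (simp add: smooth_transition_def)
qed

lemma is_chartD:
  assumes "is_chart d T (U, \<psi>)"
  shows "openin T U" and "inj_on \<psi> U"
    and "openin T O' \<Longrightarrow> O' \<subseteq> U \<Longrightarrow> openin (Euclidean_space d) (\<psi> ` O')"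
proof -
  have U: "openin T U" and im: "openin (Euclidean_space d) (\<psi> ` U)"
    and h: "homeomorphic_map (subtopology T U) (subtopology (Euclidean_space d) (\<psi> ` U)) \<psi>"
    using assms by (auto simp: is_chart_def)
  have top: "topspace (subtopology T U) = U"
    using openin_subset[OF U] by auto
  show "openin T U" by (rule U)
  show "inj_on \<psi> U"
    using homeomorphic_imp_injective_map[OF h] unfolding top .
  show "openin (Euclidean_space d) (\<psi> ` O')" if "openin T O'" "O' \<subseteq> U"
  proof -
    have "openin (subtopology T U) O'"
      using that by (simp add: openin_open_subtopology[OF U])
    then have "openin (subtopology (Euclidean_space d) (\<psi> ` U)) (\<psi> ` O')"
      using homeomorphic_imp_open_map[OF h] by (simp add: open_map_def)
    then show ?thesis using im openin_trans_full by blast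
  qed
qed

lemma charted_atlasD:
  assumes "charted M" "(U, \<psi>) \<in> atlas M"
  shows "openin (mtop M) U" "U \<subseteq> points M" "inj_on \<psi> U"
    "openin (mtop M) O' \<Longrightarrow> O' \<subseteq> U \<Longrightarrow> openin (Euclidean_space (mdim M)) (\<psi> ` O')"
proof -
  have c: "is_chart (mdim M) (mtop M) (U, \<psi>)" using assms by (auto simp: charted_def)
  show U: "openin (mtop M) U" by (rule is_chartD(1)[OF c])
  show "U \<subseteq> points M" by (rule openin_subset[OF U])
  show "inj_on \<psi> U" by (rule is_chartD(2)[OF c])
  show "openin (mtop M) O' \<Longrightarrow> O' \<subseteq> U \<Longrightarrow> openin (Euclidean_space (mdim M)) (\<psi> ` O')"
    by (rule is_chartD(3)[OF c])
qed

lemma charted_obtain_chart: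
  assumes "charted M" "p \<in> points M"
  obtains U \<psi> where "(U, \<psi>) \<in> atlas M" "p \<in> U"
proof -
  have "p \<in> (\<Union>c\<in>atlas M. fst c)" using assms by (simp add: charted_def)
  then show ?thesis using that by fastforce
qed

lemma is_chart_restrict:
  assumes c: "is_chart d T (U, \<psi>)" and W: "openin T W"
  shows "is_chart d (subtopology T W) (U \<inter> W, \<psi>)"
proof -
  have U: "openin T U" and im: "openin (Euclidean_space d) (\<psi> ` U)"
    and h: "homeomorphic_map (subtopology T U) (subtopology (Euclidean_space d) (\<psi> ` U)) \<psi>"
    using c by (auto simp: is_chart_def)
  have UW: "openin T (U \<inter> W)" using U W by blast
  have "homeomorphic_map (subtopology (subtopology T U) (U \<inter> W))
          (subtopology (subtopology (Euclidean_space d) (\<psi> ` U)) (\<psi> ` (U \<inter> W))) \<psi>"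
  proof (rule homeomorphic_map_subtopologies[OF h])
    show "\<psi> ` (topspace (subtopology T U) \<inter> (U \<inter> W)) =
          topspace (subtopology (Euclidean_space d) (\<psi> ` U)) \<inter> \<psi> ` (U \<inter> W)"
      using openin_subset[OF U] openin_subset[OF im] by auto
  qed
  moreover have "\<psi> ` U \<inter> \<psi> ` (U \<inter> W) = \<psi> ` (U \<inter> W)" "W \<inter> (U \<inter> W) = U \<inter> W" by auto
  ultimately have "homeomorphic_map (subtopology (subtopology T W) (U \<inter> W))
      (subtopology (Euclidean_space d) (\<psi> ` (U \<inter> W))) \<psi>"
    by (simp add: subtopology_subtopology)
  moreover have "openin (Euclidean_space d) (\<psi> ` (U \<inter> W))"
    using is_chartD(3)[OF c UW] by simp
  moreover have "openin (subtopology T W) (U \<inter> W)"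
    using UW by (auto simp: openin_subtopology)
  ultimately show ?thesis by (simp add: is_chart_def)
qed

lemma points_open_submanifold [simp]: "points (open_submanifold M W) = points M \<inter> W"
  by (simp add: open_submanifold_def)

lemma mdim_open_submanifold [simp]: "mdim (open_submanifold M W) = mdim M"
  by (simp add: open_submanifold_def)

lemma mtop_open_submanifold [simp]: "mtop (open_submanifold M W) = subtopology (mtop M) W"
  by (simp add: open_submanifold_def)

lemma atlas_open_submanifold: "atlas (open_submanifold M W) = (\<lambda>(U, \<psi>). (U \<inter> W, \<psi>)) ` atlas M"
  by (simp add: open_submanifold_def)

text \<open>
  The charts of the submanifold use another inverse of the coordinate map, namely the one of its
  restriction; the two inverses agree on the smaller image.
\<close>

lemma smooth_manifold_open_submanifold:
  assumes M: "smooth_manifold M" and W: "openin (mtop M) W"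
  shows "smooth_manifold (open_submanifold M W)"
proof -
  note ch = charted_atlasD[OF smooth_manifold_imp_charted[OF M]]
  have "smooth_transition (mdim M) (U \<inter> W, \<psi>) (V \<inter> W, \<psi>')"
    if UV: "(U, \<psi>) \<in> atlas M" "(V, \<psi>') \<in> atlas M" for U V \<psi> \<psi>'
  proof -
    have "smooth_on (mdim M) (\<psi> ` (U \<inter> W \<inter> (V \<inter> W))) (\<lambda>x. \<psi>' (inv_into (U \<inter> W) \<psi> x) i)"
      if "i < mdim M" for i
    proof (rule smooth_on_cong)
      show "openin (Euclidean_space (mdim M)) (\<psi> ` (U \<inter> W \<inter> (V \<inter> W)))"
        using ch(1)[OF UV(1)] ch(1)[OF UV(2)] W by (intro ch(4)[OF UV(1)] openin_Int) auto
      have "smooth_on (mdim M) (\<psi> ` (U \<inter> V)) (\<lambda>x. \<psi>' (inv_into U \<psi> x) i)"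
        by (rule smooth_manifold_transition[OF M UV that])
      then show "smooth_on (mdim M) (\<psi> ` (U \<inter> W \<inter> (V \<inter> W))) (\<lambda>x. \<psi>' (inv_into U \<psi> x) i)"
        by (rule smooth_on_subset) auto
      fix y assume "y \<in> \<psi> ` (U \<inter> W \<inter> (V \<inter> W))"
      moreover have "inj_on \<psi> (U \<inter> W)" using ch(3)[OF UV(1)] by (rule inj_on_subset) auto
      ultimately show "\<psi>' (inv_into U \<psi> y) i = \<psi>' (inv_into (U \<inter> W) \<psi> y) i"
        using ch(3)[OF UV(1)] by (auto simp: inv_into_f_f)
    qed
    then show ?thesis by (simp add: smooth_transition_def)
  qed
  then have "\<forall>c\<in>atlas (open_submanifold M W). \<forall>c'\<in>atlas (open_submanifold M W). smooth_transition (mdim M) c c'"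
    by (auto simp: atlas_open_submanifold)
  moreover have "is_chart (mdim M) (subtopology (mtop M) W) (U \<inter> W, \<psi>)" if "(U, \<psi>) \<in> atlas M" for U \<psi>
    using is_chart_restrict[OF _ W] M that by (auto simp: smooth_manifold_def)
  then have "\<forall>c\<in>atlas (open_submanifold M W). is_chart (mdim M) (subtopology (mtop M) W) c"
    by (auto simp: atlas_open_submanifold)
  moreover have "(\<Union>c\<in>atlas (open_submanifold M W). fst c) = (\<Union>c\<in>atlas M. fst c) \<inter> W"
    by (auto simp: atlas_open_submanifold split: prod.splits)
  then have "(\<Union>c\<in>atlas (open_submanifold M W). fst c) = points M \<inter> W"
    using M by (simp add: smooth_manifold_def)
  moreover have "Hausdorff_space (subtopology (mtop M) W)" "second_countable (subtopology (mtop M) W)"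
    using M by (simp_all add: smooth_manifold_def Hausdorff_space_subtopology second_countable_subtopology)
  ultimately show ?thesis
    by (simp add: smooth_manifold_def)
qed

text \<open>
  This is what makes the products of charts with Euclidean space into charts.
\<close>

lemma homeomorphic_maps_join_coords:
  "homeomorphic_maps (prod_topology (Euclidean_space d) (Euclidean_space r)) (Euclidean_space (d + r))
     (\<lambda>(x, v). join_coords d x v) (\<lambda>z. (\<lambda>i. if i < d then z i else 0, \<lambda>i. z (d + i)))"
  unfolding homeomorphic_maps_def
proof (intro conjI ballI)
  let ?P = "prod_topology (Euclidean_space d) (Euclidean_space r)"
  have proj: "continuous_map (Euclidean_space n) euclideanreal (\<lambda>x. x i)" for n i
    unfolding Euclidean_space_def
    by (rule continuous_map_from_subtopology) (metis UNIV_I continuous_map_product_coordinates)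
  have fst: "continuous_map ?P euclideanreal (\<lambda>p. fst p i)" for i
    using continuous_map_compose[OF continuous_map_fst proj[of d i]] by (simp add: o_def)
  have snd: "continuous_map ?P euclideanreal (\<lambda>p. snd p i)" for i
    using continuous_map_compose[OF continuous_map_snd proj[of r i]] by (simp add: o_def)
  show "continuous_map ?P (Euclidean_space (d + r)) (\<lambda>(x, v). join_coords d x v)"
    unfolding continuous_map_Euclidean_space_iff_components
    using fst snd by (auto simp: join_coords_def case_prod_unfold topspace_Euclidean_space)
  show "continuous_map (Euclidean_space (d + r)) ?P (\<lambda>z. (\<lambda>i. if i < d then z i else 0, \<lambda>i. z (d + i)))"
    unfolding continuous_map_pairwise o_def fst_conv snd_conv
    unfolding continuous_map_Euclidean_space_iff_components
    using proj by (auto simp: topspace_Euclidean_space)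
qed (auto simp: topspace_Euclidean_space join_coords_def fun_eq_iff)

lemma is_chart_times_Euclidean:
  assumes c: "is_chart d T (U, \<psi>)"
  shows "is_chart (d + r) (prod_topology T (Euclidean_space r))
           (U \<times> topspace (Euclidean_space r), \<lambda>(p, v). join_coords d (\<psi> p) v)"
proof -
  let ?E = "Euclidean_space r" and ?j = "\<lambda>(x, v). join_coords d x v"
  let ?V = "\<psi> ` U \<times> topspace ?E"
  have U: "openin T U" and im: "openin (Euclidean_space d) (\<psi> ` U)"
    and h: "homeomorphic_map (subtopology T U) (subtopology (Euclidean_space d) (\<psi> ` U)) \<psi>"
    using c by (auto simp: is_chart_def)
  obtain g where "homeomorphic_maps (subtopology T U) (subtopology (Euclidean_space d) (\<psi> ` U)) \<psi> g"
    using h homeomorphic_map_maps by blast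
  then have "homeomorphic_maps (prod_topology (subtopology T U) ?E)
      (prod_topology (subtopology (Euclidean_space d) (\<psi> ` U)) ?E) (\<lambda>(x, y). (\<psi> x, id y)) (\<lambda>(x, y). (g x, id y))"
    unfolding homeomorphic_maps_prod by (simp add: homeomorphic_maps_def)
  then have h1: "homeomorphic_map (subtopology (prod_topology T ?E) (U \<times> topspace ?E))
      (subtopology (prod_topology (Euclidean_space d) ?E) ?V) (\<lambda>(x, y). (\<psi> x, id y))"
    unfolding homeomorphic_map_maps prod_topology_subtopology(1) by blast
  have j: "homeomorphic_map (prod_topology (Euclidean_space d) ?E) (Euclidean_space (d + r)) ?j"
    using homeomorphic_maps_join_coords homeomorphic_map_maps by blast
  have V: "openin (prod_topology (Euclidean_space d) ?E) ?V"
    using im by (simp add: openin_prod_Times_iff)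
  then have jV: "openin (Euclidean_space (d + r)) (?j ` ?V)"
    using homeomorphic_imp_open_map[OF j] by (simp add: open_map_def)
  have "homeomorphic_map (subtopology (prod_topology (Euclidean_space d) ?E) ?V)
      (subtopology (Euclidean_space (d + r)) (?j ` ?V)) ?j"
    by (rule homeomorphic_map_subtopologies[OF j])
      (metis V jV inf.absorb_iff2 openin_subset)
  from homeomorphic_map_compose[OF h1 this]
  have "homeomorphic_map (subtopology (prod_topology T ?E) (U \<times> topspace ?E))
      (subtopology (Euclidean_space (d + r)) (?j ` ?V)) (\<lambda>(p, v). join_coords d (\<psi> p) v)"
    by (simp add: o_def case_prod_unfold)
  moreover have "?j ` ?V = (\<lambda>(p, v). join_coords d (\<psi> p) v) ` (U \<times> topspace ?E)"
    by force
  moreover have "openin (prod_topology T ?E) (U \<times> topspace ?E)"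
    using U by (simp add: openin_prod_Times_iff)
  ultimately show ?thesis using jV by (simp add: is_chart_def)
qed

lemma charted_times_Euclidean:
  assumes "charted M"
  shows "charted (times_Euclidean M r)"
  unfolding charted_def
proof
  have M: "\<And>U \<psi>. (U, \<psi>) \<in> atlas M \<Longrightarrow> is_chart (mdim M) (mtop M) (U, \<psi>)"
    "(\<Union>c\<in>atlas M. fst c) = points M"
    using assms by (simp_all add: charted_def)
  show "\<forall>c\<in>atlas (times_Euclidean M r). is_chart (mdim (times_Euclidean M r)) (mtop (times_Euclidean M r)) c"
    by (auto simp: times_Euclidean_def intro: is_chart_times_Euclidean M(1))
  have "(\<Union>c\<in>atlas (times_Euclidean M r). fst c) =
      (\<Union>c\<in>atlas M. fst c) \<times> topspace (Euclidean_space r)"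
    by (auto simp: times_Euclidean_def)
  then show "(\<Union>c\<in>atlas (times_Euclidean M r). fst c) = points (times_Euclidean M r)"
    unfolding M(2) by (simp add: times_Euclidean_def)
qed

lemma openin_chart_preimage:
  assumes "charted M" "continuous_map (mtop M) (mtop N) f" "(U, \<psi>) \<in> atlas M" "openin (mtop N) V"
  shows "openin (mtop M) (U \<inter> f -` V)"
proof -
  have "openin (mtop M) {x \<in> points M. f x \<in> V}"
    using assms(2,4) by (rule openin_continuous_map_preimage)
  moreover have "U \<inter> f -` V = U \<inter> {x \<in> points M. f x \<in> V}"
    using charted_atlasD(2)[OF assms(1,3)] by auto
  ultimately show ?thesis using charted_atlasD(1)[OF assms(1,3)] by auto
qed

lemma smooth_map_continuous: "smooth_map M N f \<Longrightarrow> continuous_map (mtop M) (mtop N) f"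
  by (simp add: smooth_map_def)

lemma smooth_map_maps_points: "smooth_map M N f \<Longrightarrow> p \<in> points M \<Longrightarrow> f p \<in> points N"
  using smooth_map_continuous continuous_map_funspace by fastforce

lemma smooth_mapD:
  assumes "smooth_map M N f" "(U, \<psi>) \<in> atlas M" "(V, \<psi>') \<in> atlas N" "j < mdim N"
  shows "smooth_on (mdim M) (\<psi> ` (U \<inter> f -` V)) (\<lambda>x. \<psi>' (f (inv_into U \<psi> x)) j)"
  using assms by (fastforce simp: smooth_map_def)

lemma smooth_mapI:
  assumes "continuous_map (mtop M) (mtop N) f"
    and "\<And>U \<psi> V \<psi>' j. \<lbrakk>(U, \<psi>) \<in> atlas M; (V, \<psi>') \<in> atlas N; j < mdim N\<rbrakk> \<Longrightarrow>
      smooth_on (mdim M) (\<psi> ` (U \<inter> f -` V)) (\<lambda>x. \<psi>' (f (inv_into U \<psi> x)) j)"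
  shows "smooth_map M N f"
  using assms by (auto simp: smooth_map_def)

text \<open>
  Smoothness is local, so near a point it suffices to insert one chart \<open>\<psi>'\<close> of the middle manifold
  between the two maps.
\<close>

lemma smooth_map_compose:
  assumes M: "charted M" and N: "charted N" and P: "charted P"
    and f: "smooth_map M N f" and g: "smooth_map N P g"
  shows "smooth_map M P (\<lambda>p. g (f p))"
proof (rule smooth_mapI)
  have cf: "continuous_map (mtop M) (mtop N) f" and cg: "continuous_map (mtop N) (mtop P) g"
    using f g by (simp_all add: smooth_map_continuous)
  show cgf: "continuous_map (mtop M) (mtop P) (\<lambda>p. g (f p))"
    using continuous_map_compose[OF cf cg] by (simp add: o_def)
  fix U \<psi> W \<psi>'' j assume U: "(U, \<psi>) \<in> atlas M" and W: "(W, \<psi>'') \<in> atlas P" and j: "j < mdim P"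
  let ?R = "\<psi> ` (U \<inter> (\<lambda>p. g (f p)) -` W)" and ?h = "\<lambda>x. \<psi>'' (g (f (inv_into U \<psi> x))) j"
  have Wo: "openin (mtop P) W" by (rule charted_atlasD(1)[OF P W])
  show "smooth_on (mdim M) ?R ?h"
  proof (rule smooth_on_local)
    fix x assume "x \<in> ?R"
    then obtain p where p: "p \<in> U" "g (f p) \<in> W" "x = \<psi> p" by auto
    then have "f p \<in> points N"
      using smooth_map_maps_points[OF f] charted_atlasD(2)[OF M U] by auto
    then obtain V \<psi>' where V: "(V, \<psi>') \<in> atlas N" "f p \<in> V"
      using charted_obtain_chart[OF N] by blast
    have Vo: "openin (mtop N) V" by (rule charted_atlasD(1)[OF N V(1)])
    define O' where "O' = (U \<inter> f -` V) \<inter> (U \<inter> (\<lambda>p. g (f p)) -` W)"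
    have "openin (mtop M) O'"
      unfolding O'_def
      by (intro openin_Int openin_chart_preimage[OF M cf U Vo] openin_chart_preimage[OF M cgf U Wo])
    then have O': "openin (Euclidean_space (mdim M)) (\<psi> ` O')"
      by (rule charted_atlasD(4)[OF M U]) (auto simp: O'_def)
    have Q: "openin (Euclidean_space (mdim N)) (\<psi>' ` (V \<inter> g -` W))"
      by (intro charted_atlasD(4)[OF N V(1)] openin_chart_preimage[OF N cg V(1) Wo]) auto
    have inv: "inv_into U \<psi> (\<psi> q) = q" if "q \<in> U" for q
      using charted_atlasD(3)[OF M U] that by simp
    have inv': "inv_into V \<psi>' (\<psi>' q) = q" if "q \<in> V" for q
      using charted_atlasD(3)[OF N V(1)] that by simp
    have "smooth_on (mdim M) (\<psi> ` O')
        (\<lambda>x. \<psi>'' (g (inv_into V \<psi>' (\<psi>' (f (inv_into U \<psi> x))))) j)"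
    proof (rule smooth_on_compose[OF O' Q, where h = "\<lambda>z. \<psi>'' (g (inv_into V \<psi>' z)) j"])
      show "smooth_on (mdim M) (\<psi> ` O') (\<lambda>x. \<psi>' (f (inv_into U \<psi> x)) i)" if "i < mdim N" for i
        by (rule smooth_on_subset[OF smooth_mapD[OF f U V(1) that]]) (auto simp: O'_def)
      show "smooth_on (mdim N) (\<psi>' ` (V \<inter> g -` W)) (\<lambda>z. \<psi>'' (g (inv_into V \<psi>' z)) j)"
        by (rule smooth_mapD[OF g V(1) W j])
    qed (auto simp: O'_def inv)
    then have smooth: "smooth_on (mdim M) (\<psi> ` O') ?h"
      by (rule smooth_on_cong[OF O', rotated]) (auto simp: O'_def inv inv')
    have "x \<in> \<psi> ` O'" "\<psi> ` O' \<subseteq> ?R"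
      using p V by (auto simp: O'_def)
    then show "\<exists>V. x \<in> V \<and> V \<subseteq> ?R \<and> openin (Euclidean_space (mdim M)) V \<and> smooth_on (mdim M) V ?h"
      by (intro exI[of _ "\<psi> ` O'"] conjI O' smooth)
  qed
qed

lemma smooth_map_cong:
  assumes M: "charted M" and N: "charted N" and f: "smooth_map M N f"
    and eq: "\<And>p. p \<in> points M \<Longrightarrow> f p = g p"
  shows "smooth_map M N g"
proof (rule smooth_mapI)
  have cf: "continuous_map (mtop M) (mtop N) f" by (rule smooth_map_continuous[OF f])
  show cg: "continuous_map (mtop M) (mtop N) g"
    by (rule continuous_map_eq[OF cf eq])
  fix U \<psi> V \<psi>' j assume U: "(U, \<psi>) \<in> atlas M" and V: "(V, \<psi>') \<in> atlas N" and j: "j < mdim N"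
  have UM: "U \<subseteq> points M" by (rule charted_atlasD(2)[OF M U])
  then have dom: "U \<inter> g -` V = U \<inter> f -` V" using eq by (auto simp: subset_iff)
  show "smooth_on (mdim M) (\<psi> ` (U \<inter> g -` V)) (\<lambda>x. \<psi>' (g (inv_into U \<psi> x)) j)"
    unfolding dom
  proof (rule smooth_on_cong[OF _ _ smooth_mapD[OF f U V j]])
    show "openin (Euclidean_space (mdim M)) (\<psi> ` (U \<inter> f -` V))"
      by (intro charted_atlasD(4)[OF M U] openin_chart_preimage[OF M cf U] charted_atlasD(1)[OF N V]) auto
    show "\<psi>' (f (inv_into U \<psi> y)) j = \<psi>' (g (inv_into U \<psi> y)) j" if "y \<in> \<psi> ` (U \<inter> f -` V)" for y
      using that UM charted_atlasD(3)[OF M U] eq by (auto simp: subset_iff)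
  qed
qed

lemma inv_into_Int_eq:
  assumes "inj_on \<psi> U" "x \<in> \<psi> ` (U \<inter> W)"
  shows "inv_into (U \<inter> W) \<psi> x = inv_into U \<psi> x"
proof -
  have "inj_on \<psi> (U \<inter> W)" using assms(1) by (rule inj_on_subset) auto
  then show ?thesis using assms by auto
qed

lemma smooth_map_open_submanifold_domain:
  assumes M: "charted M" and N: "charted N" and f: "smooth_map M N f" and W: "openin (mtop M) W"
  shows "smooth_map (open_submanifold M W) N f"
proof (rule smooth_mapI)
  have cf: "continuous_map (mtop M) (mtop N) f" by (rule smooth_map_continuous[OF f])
  show "continuous_map (mtop (open_submanifold M W)) (mtop N) f"
    using cf by (simp add: continuous_map_from_subtopology)
  fix U' \<psi> V \<psi>' j assume "(U', \<psi>) \<in> atlas (open_submanifold M W)" and V: "(V, \<psi>') \<in> atlas N" and j: "j < mdim N"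
  then obtain U where U: "(U, \<psi>) \<in> atlas M" "U' = U \<inter> W"
    by (auto simp: atlas_open_submanifold)
  have "smooth_on (mdim M) (\<psi> ` (U \<inter> W \<inter> f -` V)) (\<lambda>x. \<psi>' (f (inv_into (U \<inter> W) \<psi> x)) j)"
  proof (rule smooth_on_cong)
    have "openin (mtop M) ((U \<inter> f -` V) \<inter> W)"
      by (intro openin_Int openin_chart_preimage[OF M cf U(1)] charted_atlasD(1)[OF N V] W)
    then show "openin (Euclidean_space (mdim M)) (\<psi> ` (U \<inter> W \<inter> f -` V))"
      by (intro charted_atlasD(4)[OF M U(1)]) (auto simp: Int_ac)
    show "smooth_on (mdim M) (\<psi> ` (U \<inter> W \<inter> f -` V)) (\<lambda>x. \<psi>' (f (inv_into U \<psi> x)) j)"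
      by (rule smooth_on_subset[OF smooth_mapD[OF f U(1) V j]]) auto
    show "\<psi>' (f (inv_into U \<psi> y)) j = \<psi>' (f (inv_into (U \<inter> W) \<psi> y)) j"
      if "y \<in> \<psi> ` (U \<inter> W \<inter> f -` V)" for y
      using inv_into_Int_eq[OF charted_atlasD(3)[OF M U(1)], of y W] that by auto
  qed
  then show "smooth_on (mdim (open_submanifold M W)) (\<psi> ` (U' \<inter> f -` V)) (\<lambda>x. \<psi>' (f (inv_into U' \<psi> x)) j)"
    by (simp add: U(2))
qed

lemma smooth_map_into_open_submanifold_iff:
  assumes M: "charted M" and f: "\<And>p. p \<in> points M \<Longrightarrow> f p \<in> W"
  shows "smooth_map M (open_submanifold N W) f \<longleftrightarrow> smooth_map M N f"
proof -
  have dom: "U \<inter> f -` (V \<inter> W) = U \<inter> f -` V" if "(U, \<psi>) \<in> atlas M" for U V \<psi>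
    using charted_atlasD(2)[OF M that] f by auto
  have cont: "continuous_map (mtop M) (subtopology (mtop N) W) f \<longleftrightarrow> continuous_map (mtop M) (mtop N) f"
    using f by (auto simp: continuous_map_in_subtopology)
  show ?thesis
  proof
    assume L: "smooth_map M (open_submanifold N W) f"
    show "smooth_map M N f"
    proof (rule smooth_mapI)
      show "continuous_map (mtop M) (mtop N) f"
        using smooth_map_continuous[OF L] cont by simp
      fix U \<psi> V \<psi>' j assume U: "(U, \<psi>) \<in> atlas M" and V: "(V, \<psi>') \<in> atlas N" and j: "j < mdim N"
      have "(V \<inter> W, \<psi>') \<in> atlas (open_submanifold N W)"
        using V by (force simp: atlas_open_submanifold)
      from smooth_mapD[OF L U this] j
      show "smooth_on (mdim M) (\<psi> ` (U \<inter> f -` V)) (\<lambda>x. \<psi>' (f (inv_into U \<psi> x)) j)"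
        unfolding dom[OF U] by simp
    qed
  next
    assume R: "smooth_map M N f"
    show "smooth_map M (open_submanifold N W) f"
    proof (rule smooth_mapI)
      show "continuous_map (mtop M) (mtop (open_submanifold N W)) f"
        using smooth_map_continuous[OF R] cont by simp
      fix U \<psi> V' \<psi>' j assume U: "(U, \<psi>) \<in> atlas M" and "(V', \<psi>') \<in> atlas (open_submanifold N W)"
        and j: "j < mdim (open_submanifold N W)"
      then obtain V where V: "(V, \<psi>') \<in> atlas N" "V' = V \<inter> W"
        by (auto simp: atlas_open_submanifold)
      from smooth_mapD[OF R U V(1)] j
      show "smooth_on (mdim M) (\<psi> ` (U \<inter> f -` V')) (\<lambda>x. \<psi>' (f (inv_into U \<psi> x)) j)"
        unfolding V(2) dom[OF U] by simp
    qed
  qed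
qed

lemma smooth_map_local:
  assumes M: "charted M" and N: "charted N"
    and loc: "\<And>p. p \<in> points M \<Longrightarrow> \<exists>W. p \<in> W \<and> openin (mtop M) W \<and> smooth_map (open_submanifold M W) N f"
  shows "smooth_map M N f"
proof (rule smooth_mapI)
  let ?I = "{W. openin (mtop M) W \<and> smooth_map (open_submanifold M W) N f}"
  show cf: "continuous_map (mtop M) (mtop N) f"
  proof (rule pasting_lemma[where I = ?I and T = "\<lambda>W. W" and f = "\<lambda>_. f"])
    fix W assume "W \<in> ?I"
    then show "continuous_map (subtopology (mtop M) W) (mtop N) f"
      using smooth_map_continuous by fastforce
  qed (use loc in auto)
  fix U \<psi> V \<psi>' j assume U: "(U, \<psi>) \<in> atlas M" and V: "(V, \<psi>') \<in> atlas N" and j: "j < mdim N"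
  let ?R = "\<psi> ` (U \<inter> f -` V)" and ?h = "\<lambda>x. \<psi>' (f (inv_into U \<psi> x)) j"
  show "smooth_on (mdim M) ?R ?h"
  proof (rule smooth_on_local)
    fix x assume "x \<in> ?R"
    then obtain p where p: "p \<in> U" "f p \<in> V" "x = \<psi> p" by auto
    then obtain W where W: "p \<in> W" "openin (mtop M) W" "smooth_map (open_submanifold M W) N f"
      using loc charted_atlasD(2)[OF M U] by blast
    have "openin (mtop M) ((U \<inter> f -` V) \<inter> W)"
      by (intro openin_Int openin_chart_preimage[OF M cf U] charted_atlasD(1)[OF N V] W)
    then have O': "openin (Euclidean_space (mdim M)) (\<psi> ` (U \<inter> W \<inter> f -` V))"
      by (intro charted_atlasD(4)[OF M U]) (auto simp: Int_ac)
    have "(U \<inter> W, \<psi>) \<in> atlas (open_submanifold M W)"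
      using U by (force simp: atlas_open_submanifold)
    from smooth_mapD[OF W(3) this V j]
    have "smooth_on (mdim M) (\<psi> ` (U \<inter> W \<inter> f -` V)) (\<lambda>x. \<psi>' (f (inv_into (U \<inter> W) \<psi> x)) j)"
      by simp
    then have smooth: "smooth_on (mdim M) (\<psi> ` (U \<inter> W \<inter> f -` V)) ?h"
    proof (rule smooth_on_cong[OF O', rotated])
      show "\<psi>' (f (inv_into (U \<inter> W) \<psi> y)) j = \<psi>' (f (inv_into U \<psi> y)) j"
        if "y \<in> \<psi> ` (U \<inter> W \<inter> f -` V)" for y
        using inv_into_Int_eq[OF charted_atlasD(3)[OF M U], of y W] that by auto
    qed
    have "x \<in> \<psi> ` (U \<inter> W \<inter> f -` V)" "\<psi> ` (U \<inter> W \<inter> f -` V) \<subseteq> ?R"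
      using p W by auto
    then show "\<exists>V. x \<in> V \<and> V \<subseteq> ?R \<and> openin (Euclidean_space (mdim M)) V \<and> smooth_on (mdim M) V ?h"
      by (intro exI[of _ "\<psi> ` (U \<inter> W \<inter> f -` V)"] conjI O' smooth)
  qed
qed

text \<open>
  Smoothness of a real function, as in \<open>smooth_functions\<close> but with arbitrary values off \<open>M\<close>.
\<close>

definition smooth_in_charts :: "'p manifold \<Rightarrow> ('p \<Rightarrow> real) \<Rightarrow> bool" where
  "smooth_in_charts M s \<longleftrightarrow> (\<forall>(U, \<psi>)\<in>atlas M. smooth_on (mdim M) (\<psi> ` U) (\<lambda>x. s (inv_into U \<psi> x)))"

lemma smooth_in_charts_add:
  "\<lbrakk>smooth_in_charts M s; smooth_in_charts M t\<rbrakk> \<Longrightarrow> smooth_in_charts M (\<lambda>p. s p + t p)"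
  unfolding smooth_in_charts_def by (auto intro!: smooth_on_add)

lemma smooth_in_charts_cmult: "smooth_in_charts M s \<Longrightarrow> smooth_in_charts M (\<lambda>p. c * s p)"
  unfolding smooth_in_charts_def by (auto intro!: smooth_on_cmult)

text \<open>
  The first components are handled by the compatibility of the charts, which says that the identity is
  smooth.
\<close>

lemma smooth_map_graph:
  assumes M: "smooth_manifold M"
    and s: "continuous_map (mtop M) (Euclidean_space r) s"
    and comp: "\<And>j. j < r \<Longrightarrow> smooth_in_charts M (\<lambda>p. s p j)"
  shows "smooth_map M (times_Euclidean M r) (\<lambda>p. (p, s p))"
proof (rule smooth_mapI)
  note ch = charted_atlasD[OF smooth_manifold_imp_charted[OF M]]
  show "continuous_map (mtop M) (mtop (times_Euclidean M r)) (\<lambda>p. (p, s p))"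
    using s by (simp add: times_Euclidean_def continuous_map_paired)
  fix U \<psi> V' \<psi>'' j
  assume U: "(U, \<psi>) \<in> atlas M" and "(V', \<psi>'') \<in> atlas (times_Euclidean M r)" and j: "j < mdim (times_Euclidean M r)"
  then obtain V \<psi>' where V: "(V, \<psi>') \<in> atlas M" "V' = V \<times> topspace (Euclidean_space r)"
    "\<psi>'' = (\<lambda>(p, v). join_coords (mdim M) (\<psi>' p) v)"
    by (auto simp: times_Euclidean_def)
  have "s p \<in> topspace (Euclidean_space r)" if "p \<in> U" for p
    using continuous_map_funspace[OF s] ch(2)[OF U] that by auto
  then have dom: "U \<inter> (\<lambda>p. (p, s p)) -` V' = U \<inter> V" by (auto simp: V(2))
  have "smooth_on (mdim M) (\<psi> ` (U \<inter> V))
      (\<lambda>x. join_coords (mdim M) (\<psi>' (inv_into U \<psi> x)) (s (inv_into U \<psi> x)) j)"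
  proof (cases "j < mdim M")
    case True
    then show ?thesis
      using smooth_manifold_transition[OF M U V(1) True] by (simp add: join_coords_def)
  next
    case False
    then have "smooth_in_charts M (\<lambda>p. s p (j - mdim M))"
      using j by (intro comp) (simp add: times_Euclidean_def)
    then have "smooth_on (mdim M) (\<psi> ` U) (\<lambda>x. s (inv_into U \<psi> x) (j - mdim M))"
      using U by (auto simp: smooth_in_charts_def)
    then have "smooth_on (mdim M) (\<psi> ` (U \<inter> V)) (\<lambda>x. s (inv_into U \<psi> x) (j - mdim M))"
      by (rule smooth_on_subset) auto
    then show ?thesis using False by (simp add: join_coords_def)
  qed
  then show "smooth_on (mdim M) (\<psi> ` (U \<inter> (\<lambda>p. (p, s p)) -` V'))
      (\<lambda>x. \<psi>'' (inv_into U \<psi> x, s (inv_into U \<psi> x)) j)"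
    unfolding dom by (simp add: V(3))
qed

lemma smooth_map_graphD:
  assumes M: "charted M" and F: "smooth_map M (times_Euclidean M r) (\<lambda>p. (p, s p))"
  shows "continuous_map (mtop M) (Euclidean_space r) s"
    and "j < r \<Longrightarrow> smooth_in_charts M (\<lambda>p. s p j)"
proof -
  show c: "continuous_map (mtop M) (Euclidean_space r) s"
    using smooth_map_continuous[OF F] by (simp add: times_Euclidean_def continuous_map_paired)
  assume j: "j < r"
  show "smooth_in_charts M (\<lambda>p. s p j)"
    unfolding smooth_in_charts_def
  proof clarify
    fix U \<psi> assume U: "(U, \<psi>) \<in> atlas M"
    let ?E = "topspace (Euclidean_space r)" and ?c = "\<lambda>(p, v). join_coords (mdim M) (\<psi> p) v"
    have "(U \<times> ?E, ?c) \<in> atlas (times_Euclidean M r)"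
      using U by (force simp: times_Euclidean_def)
    moreover have "mdim M + j < mdim (times_Euclidean M r)"
      using j by (simp add: times_Euclidean_def)
    ultimately have "smooth_on (mdim M) (\<psi> ` (U \<inter> (\<lambda>p. (p, s p)) -` (U \<times> ?E)))
        (\<lambda>x. ?c (inv_into U \<psi> x, s (inv_into U \<psi> x)) (mdim M + j))"
      by (rule smooth_mapD[OF F U])
    moreover have "s p \<in> ?E" if "p \<in> U" for p
      using continuous_map_funspace[OF c] charted_atlasD(2)[OF M U] that by auto
    then have "U \<inter> (\<lambda>p. (p, s p)) -` (U \<times> ?E) = U" by auto
    ultimately show "smooth_on (mdim M) (\<psi> ` U) (\<lambda>x. s (inv_into U \<psi> x) j)"
      by (simp add: join_coords_def)
  qed
qed


section \<open>The vector space of sections of a vector bundle\<close>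

lemma real_ring_simps [simp]:
  "carrier real_ring = UNIV" "\<zero>\<^bsub>real_ring\<^esub> = 0" "\<one>\<^bsub>real_ring\<^esub> = 1"
  "x \<oplus>\<^bsub>real_ring\<^esub> y = x + y" "x \<otimes>\<^bsub>real_ring\<^esub> y = x * y"
  by (simp_all add: real_ring_def)

lemma section_iff:
  "X \<in> carrier (\<Gamma> A) \<longleftrightarrow> X \<in> extensional (points (base A)) \<and>
     smooth_map (base A) (total_space A) X \<and> (\<forall>p\<in>points (base A). bundle_proj A (X p) = p)"
  by (simp add: sections_def)

lemma section_operations:
  "X \<oplus>\<^bsub>\<Gamma> A\<^esub> Y = (\<lambda>p\<in>points (base A). X p \<oplus>\<^bsub>fibre A p\<^esub> Y p)"
  "\<zero>\<^bsub>\<Gamma> A\<^esub> = (\<lambda>p\<in>points (base A). \<zero>\<^bsub>fibre A p\<^esub>)"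
  "real_smult A c X = (\<lambda>p\<in>points (base A). c \<odot>\<^bsub>fibre A p\<^esub> X p)"
  by (auto simp: sections_def real_smult_def)

lemma vector_bundleD:
  assumes "vector_bundle A"
  shows "smooth_manifold (base A)" "smooth_manifold (total_space A)"
    "smooth_map (total_space A) (base A) (bundle_proj A)"
    "p \<in> points (base A) \<Longrightarrow> carrier (fibre A p) = {e \<in> points (total_space A). bundle_proj A e = p}"
    "p \<in> points (base A) \<Longrightarrow> Module.module real_ring (fibre A p)"
    "p \<in> points (base A) \<Longrightarrow> \<exists>U \<phi>. p \<in> U \<and> local_trivialization A U \<phi>"
  using assms by (simp_all add: vector_bundle_def)

lemma section_in_fibre:
  assumes "vector_bundle A" "X \<in> carrier (\<Gamma> A)" "p \<in> points (base A)"
  shows "X p \<in> carrier (fibre A p)"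
  using assms smooth_map_maps_points[of "base A" "total_space A" X p]
  by (simp add: vector_bundleD(4) section_iff)

lemma local_trivialization_linear:
  assumes "local_trivialization A U \<phi>" "p \<in> U" "e \<in> carrier (fibre A p)"
  shows "e' \<in> carrier (fibre A p) \<Longrightarrow> \<phi> (e \<oplus>\<^bsub>fibre A p\<^esub> e') = (\<lambda>i. \<phi> e i + \<phi> e' i)"
    and "\<phi> (c \<odot>\<^bsub>fibre A p\<^esub> e) = (\<lambda>i. c * \<phi> e i)"
  using assms by (auto simp: local_trivialization_def)

text \<open>
  These facts allow maps between the base, the total space and the product to be composed.
\<close>

lemma charted_local_trivialization:
  assumes A: "vector_bundle A" and U: "local_trivialization A U \<phi>"
  defines "B \<equiv> open_submanifold (base A) U"
    and "T \<equiv> open_submanifold (total_space A) {e \<in> points (total_space A). bundle_proj A e \<in> U}"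
  shows "openin (mtop (base A)) U" "smooth_manifold B" "charted T" "charted (times_Euclidean B r)"
proof -
  show Uo: "openin (mtop (base A)) U" using U by (simp add: local_trivialization_def)
  show B: "smooth_manifold B"
    unfolding B_def by (rule smooth_manifold_open_submanifold[OF vector_bundleD(1)[OF A] Uo])
  show "charted T"
    unfolding T_def
    by (intro smooth_manifold_imp_charted smooth_manifold_open_submanifold vector_bundleD(2)[OF A]
        openin_continuous_map_preimage[OF smooth_map_continuous[OF vector_bundleD(3)[OF A]] Uo])
  show "charted (times_Euclidean B r)"
    by (rule charted_times_Euclidean[OF smooth_manifold_imp_charted[OF B]])
qed

text \<open>
  The coordinates of \<open>X\<close> are the second component of the composition of \<open>X\<close> with the trivialization.
\<close>

lemma section_coordinates_smooth:
  assumes A: "vector_bundle A" and U: "local_trivialization A U \<phi>" and X: "X \<in> carrier (\<Gamma> A)"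
  shows "continuous_map (subtopology (mtop (base A)) U) (Euclidean_space (bundle_rank A)) (\<lambda>p. \<phi> (X p))"
    and "j < bundle_rank A \<Longrightarrow> smooth_in_charts (open_submanifold (base A) U) (\<lambda>p. \<phi> (X p) j)"
proof -
  let ?B = "open_submanifold (base A) U"
  let ?T = "open_submanifold (total_space A) {e \<in> points (total_space A). bundle_proj A e \<in> U}"
  let ?P = "times_Euclidean ?B (bundle_rank A)"
  note c = charted_local_trivialization[OF A U]
  have cB: "charted ?B" by (rule smooth_manifold_imp_charted[OF c(2)])
  have sX: "smooth_map (base A) (total_space A) X" "\<And>p. p \<in> points (base A) \<Longrightarrow> bundle_proj A (X p) = p"
    using X by (auto simp: section_iff)
  have "smooth_map ?B (total_space A) X"
    using vector_bundleD(1,2)[OF A] sX(1) c(1)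
    by (intro smooth_map_open_submanifold_domain smooth_manifold_imp_charted)
  moreover have "X p \<in> {e \<in> points (total_space A). bundle_proj A e \<in> U}" if "p \<in> points ?B" for p
    using that sX(2) smooth_map_maps_points[OF sX(1)] by auto
  ultimately have "smooth_map ?B ?T X"
    using smooth_map_into_open_submanifold_iff[OF cB] by blast
  moreover have "smooth_map ?T ?P (\<lambda>e. (bundle_proj A e, \<phi> e))"
    using U by (auto simp: local_trivialization_def diffeomorphism_def)
  ultimately have "smooth_map ?B ?P (\<lambda>p. (bundle_proj A (X p), \<phi> (X p)))"
    by (rule smooth_map_compose[OF cB c(3,4)])
  then have G: "smooth_map ?B ?P (\<lambda>p. (p, \<phi> (X p)))"
    by (rule smooth_map_cong[OF cB c(4)]) (simp add: sX(2))
  show "continuous_map (subtopology (mtop (base A)) U) (Euclidean_space (bundle_rank A)) (\<lambda>p. \<phi> (X p))"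
    using smooth_map_graphD(1)[OF cB G] by simp
  show "j < bundle_rank A \<Longrightarrow> smooth_in_charts ?B (\<lambda>p. \<phi> (X p) j)"
    by (rule smooth_map_graphD(2)[OF cB G])
qed

text \<open>
  \<open>Z\<close> is the composition of the graph of its coordinates with the inverse of the trivialization.
\<close>

lemma smooth_map_if_coordinates_smooth:
  assumes A: "vector_bundle A" and U: "local_trivialization A U \<phi>"
    and Z: "\<And>p. p \<in> U \<Longrightarrow> Z p \<in> carrier (fibre A p)"
    and cont: "continuous_map (subtopology (mtop (base A)) U) (Euclidean_space (bundle_rank A)) (\<lambda>p. \<phi> (Z p))"
    and smooth: "\<And>j. j < bundle_rank A \<Longrightarrow> smooth_in_charts (open_submanifold (base A) U) (\<lambda>p. \<phi> (Z p) j)"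
  shows "smooth_map (open_submanifold (base A) U) (total_space A) Z"
proof -
  let ?B = "open_submanifold (base A) U"
  let ?W = "{e \<in> points (total_space A). bundle_proj A e \<in> U}"
  let ?T = "open_submanifold (total_space A) ?W"
  let ?P = "times_Euclidean ?B (bundle_rank A)"
  note c = charted_local_trivialization[OF A U]
  have cB: "charted ?B" by (rule smooth_manifold_imp_charted[OF c(2)])
  obtain g where g: "smooth_map ?P ?T g" "\<And>e. e \<in> points ?T \<Longrightarrow> g (bundle_proj A e, \<phi> e) = e"
    using U by (auto simp: local_trivialization_def diffeomorphism_def)
  have Zp: "Z p \<in> ?W" "bundle_proj A (Z p) = p" if "p \<in> points ?B" for p
    using Z[of p] that vector_bundleD(4)[OF A, of p] by auto
  have "smooth_map ?B ?P (\<lambda>p. (p, \<phi> (Z p)))"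
    by (rule smooth_map_graph[OF c(2)]) (use cont smooth in auto)
  then have "smooth_map ?B ?T (\<lambda>p. g (p, \<phi> (Z p)))"
    by (rule smooth_map_compose[OF cB c(4,3) _ g(1)])
  then have "smooth_map ?B ?T Z"
  proof (rule smooth_map_cong[OF cB c(3)])
    fix p assume "p \<in> points ?B"
    then show "g (p, \<phi> (Z p)) = Z p"
      using g(2)[of "Z p"] Zp by auto
  qed
  then show ?thesis
    using smooth_map_into_open_submanifold_iff[OF cB, of Z ?W] Zp(1) by blast
qed

lemma sectionI:
  assumes A: "vector_bundle A" and ext: "Z \<in> extensional (points (base A))"
    and Z: "\<And>p. p \<in> points (base A) \<Longrightarrow> Z p \<in> carrier (fibre A p)"
    and cont: "\<And>U \<phi>. local_trivialization A U \<phi> \<Longrightarrow>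
      continuous_map (subtopology (mtop (base A)) U) (Euclidean_space (bundle_rank A)) (\<lambda>p. \<phi> (Z p))"
    and smooth: "\<And>U \<phi> j. \<lbrakk>local_trivialization A U \<phi>; j < bundle_rank A\<rbrakk> \<Longrightarrow>
      smooth_in_charts (open_submanifold (base A) U) (\<lambda>p. \<phi> (Z p) j)"
  shows "Z \<in> carrier (\<Gamma> A)"
proof -
  have "smooth_map (base A) (total_space A) Z"
  proof (rule smooth_map_local)
    fix p assume "p \<in> points (base A)"
    then obtain U \<phi> where U: "p \<in> U" "local_trivialization A U \<phi>"
      using vector_bundleD(6)[OF A] by blast
    have Uo: "openin (mtop (base A)) U" by (rule charted_local_trivialization(1)[OF A U(2)])
    have "smooth_map (open_submanifold (base A) U) (total_space A) Z"
      using Z openin_subset[OF Uo]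
      by (intro smooth_map_if_coordinates_smooth[OF A U(2)] cont smooth U(2)) auto
    with U Uo show "\<exists>W. p \<in> W \<and> openin (mtop (base A)) W \<and> smooth_map (open_submanifold (base A) W) (total_space A) Z"
      by blast
  qed (intro smooth_manifold_imp_charted vector_bundleD(1,2)[OF A])+
  moreover have "bundle_proj A (Z p) = p" if "p \<in> points (base A)" for p
    using Z[OF that] that by (simp add: vector_bundleD(4)[OF A])
  ultimately show ?thesis using ext by (simp add: section_iff)
qed

lemma smooth_in_charts_cong:
  assumes "charted M" "\<And>p. p \<in> points M \<Longrightarrow> s p = t p" "smooth_in_charts M s"
  shows "smooth_in_charts M t"
  unfolding smooth_in_charts_def
proof clarify
  fix U \<psi> assume U: "(U, \<psi>) \<in> atlas M"
  note ch = charted_atlasD[OF assms(1) U]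
  have "smooth_on (mdim M) (\<psi> ` U) (\<lambda>x. s (inv_into U \<psi> x))"
    using assms(3) U by (auto simp: smooth_in_charts_def)
  then show "smooth_on (mdim M) (\<psi> ` U) (\<lambda>x. t (inv_into U \<psi> x))"
    by (rule smooth_on_cong[rotated 2]) (use ch assms(2) in \<open>auto simp: subset_iff\<close>)
qed

text \<open>
  The form of \<open>sectionI\<close> used for the operations on sections: by linearity of the trivialization on
  fibres, the coordinates of the result are given by a formula \<open>s\<close> in the coordinates of the arguments.
\<close>

lemma section_if_coordinates_eq:
  assumes A: "vector_bundle A" and ext: "Z \<in> extensional (points (base A))"
    and Z: "\<And>p. p \<in> points (base A) \<Longrightarrow> Z p \<in> carrier (fibre A p)"
    and eq: "\<And>U \<phi> p. \<lbrakk>local_trivialization A U \<phi>; p \<in> U; p \<in> points (base A)\<rbrakk> \<Longrightarrow> \<phi> (Z p) = s \<phi> p"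
    and cont: "\<And>U \<phi>. local_trivialization A U \<phi> \<Longrightarrow>
      continuous_map (subtopology (mtop (base A)) U) (Euclidean_space (bundle_rank A)) (s \<phi>)"
    and smooth: "\<And>U \<phi> j. \<lbrakk>local_trivialization A U \<phi>; j < bundle_rank A\<rbrakk> \<Longrightarrow>
      smooth_in_charts (open_submanifold (base A) U) (\<lambda>p. s \<phi> p j)"
  shows "Z \<in> carrier (\<Gamma> A)"
proof (rule sectionI[OF A ext Z])
  fix U \<phi> assume U: "local_trivialization A U \<phi>"
  show "continuous_map (subtopology (mtop (base A)) U) (Euclidean_space (bundle_rank A)) (\<lambda>p. \<phi> (Z p))"
    using cont[OF U] by (rule continuous_map_eq) (use eq[OF U] in simp)
  have "charted (open_submanifold (base A) U)"
    by (rule smooth_manifold_imp_charted[OF charted_local_trivialization(2)[OF A U]])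
  then show "smooth_in_charts (open_submanifold (base A) U) (\<lambda>p. \<phi> (Z p) j)" if "j < bundle_rank A" for j
    by (rule smooth_in_charts_cong[OF _ _ smooth[OF U that]]) (use eq[OF U] in simp)
qed

lemma section_add_closed:
  assumes A: "vector_bundle A" and X: "X \<in> carrier (\<Gamma> A)" and Y: "Y \<in> carrier (\<Gamma> A)"
  shows "X \<oplus>\<^bsub>\<Gamma> A\<^esub> Y \<in> carrier (\<Gamma> A)"
  unfolding section_operations
proof (rule section_if_coordinates_eq[OF A, where s = "\<lambda>\<phi> p i. \<phi> (X p) i + \<phi> (Y p) i"])
  fix p assume p: "p \<in> points (base A)"
  interpret F: Module.module real_ring "fibre A p" by (rule vector_bundleD(5)[OF A p])
  show "(\<lambda>p\<in>points (base A). X p \<oplus>\<^bsub>fibre A p\<^esub> Y p) p \<in> carrier (fibre A p)"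
    using p section_in_fibre[OF A X p] section_in_fibre[OF A Y p] by simp
next
  fix U \<phi> p assume "local_trivialization A U \<phi>" "p \<in> U" "p \<in> points (base A)"
  then show "\<phi> ((\<lambda>p\<in>points (base A). X p \<oplus>\<^bsub>fibre A p\<^esub> Y p) p) = (\<lambda>i. \<phi> (X p) i + \<phi> (Y p) i)"
    using section_in_fibre[OF A X] section_in_fibre[OF A Y] by (simp add: local_trivialization_linear(1))
next
  fix U \<phi> assume U: "local_trivialization A U \<phi>"
  note cX = section_coordinates_smooth[OF A U X] and cY = section_coordinates_smooth[OF A U Y]
  show "continuous_map (subtopology (mtop (base A)) U) (Euclidean_space (bundle_rank A))
      (\<lambda>p i. \<phi> (X p) i + \<phi> (Y p) i)"
    by (rule continuous_map_Euclidean_space_add[OF cX(1) cY(1)])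
  show "smooth_in_charts (open_submanifold (base A) U) (\<lambda>p. \<phi> (X p) j + \<phi> (Y p) j)" if "j < bundle_rank A" for j
    by (rule smooth_in_charts_add[OF cX(2)[OF that] cY(2)[OF that]])
qed simp

lemma section_smult_closed:
  assumes A: "vector_bundle A" and X: "X \<in> carrier (\<Gamma> A)"
  shows "real_smult A c X \<in> carrier (\<Gamma> A)"
  unfolding section_operations
proof (rule section_if_coordinates_eq[OF A, where s = "\<lambda>\<phi> p i. c * \<phi> (X p) i"])
  fix p assume p: "p \<in> points (base A)"
  interpret F: Module.module real_ring "fibre A p" by (rule vector_bundleD(5)[OF A p])
  show "(\<lambda>p\<in>points (base A). c \<odot>\<^bsub>fibre A p\<^esub> X p) p \<in> carrier (fibre A p)"
    using p section_in_fibre[OF A X p] by simp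
next
  fix U \<phi> p assume "local_trivialization A U \<phi>" "p \<in> U" "p \<in> points (base A)"
  then show "\<phi> ((\<lambda>p\<in>points (base A). c \<odot>\<^bsub>fibre A p\<^esub> X p) p) = (\<lambda>i. c * \<phi> (X p) i)"
    using section_in_fibre[OF A X] by (simp add: local_trivialization_linear(2))
next
  fix U \<phi> assume U: "local_trivialization A U \<phi>"
  show "smooth_in_charts (open_submanifold (base A) U) (\<lambda>p. c * \<phi> (X p) j)" if "j < bundle_rank A" for j
    by (rule smooth_in_charts_cmult[OF section_coordinates_smooth(2)[OF A U X that]])
  from section_coordinates_smooth(1)[OF A U X]
  show "continuous_map (subtopology (mtop (base A)) U) (Euclidean_space (bundle_rank A)) (\<lambda>p i. c * \<phi> (X p) i)"
    by (auto simp: continuous_map_Euclidean_space_iff_components intro: continuous_map_real_mult)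
qed simp

lemma section_zero_closed:
  assumes A: "vector_bundle A"
  shows "\<zero>\<^bsub>\<Gamma> A\<^esub> \<in> carrier (\<Gamma> A)"
  unfolding section_operations
proof (rule section_if_coordinates_eq[OF A, where s = "\<lambda>\<phi> p i. 0"])
  fix p assume p: "p \<in> points (base A)"
  interpret F: Module.module real_ring "fibre A p" by (rule vector_bundleD(5)[OF A p])
  show "(\<lambda>p\<in>points (base A). \<zero>\<^bsub>fibre A p\<^esub>) p \<in> carrier (fibre A p)"
    using p by simp
  fix U \<phi> assume U: "local_trivialization A U \<phi>" "p \<in> U"
  \<comment> \<open>The zero vector is 0 times itself, and a trivialization preserves scalar multiples.\<close>
  have "\<phi> (0 \<odot>\<^bsub>fibre A p\<^esub> \<zero>\<^bsub>fibre A p\<^esub>) = (\<lambda>i. 0)"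
    using local_trivialization_linear(2)[OF U F.zero_closed, of 0] by simp
  then show "\<phi> ((\<lambda>p\<in>points (base A). \<zero>\<^bsub>fibre A p\<^esub>) p) = (\<lambda>i. 0)"
    using p F.smult_l_null[of "\<zero>\<^bsub>fibre A p\<^esub>"] by simp
next
  show "continuous_map (subtopology (mtop (base A)) U) (Euclidean_space (bundle_rank A)) (\<lambda>p i. 0)" for U
    unfolding continuous_map_Euclidean_space_iff_components by simp
qed (auto simp: smooth_in_charts_def smooth_on_def Ck_on_const)

lemma section_eqI:
  assumes "X \<in> carrier (\<Gamma> A)" "Y \<in> carrier (\<Gamma> A)" "\<And>p. p \<in> points (base A) \<Longrightarrow> X p = Y p"
  shows "X = Y"
  using assms by (auto simp: section_iff intro: extensionalityI)

lemma real_smult_simps: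
  assumes A: "vector_bundle A" and X: "X \<in> carrier (\<Gamma> A)"
  shows "real_smult A c (real_smult A c' X) = real_smult A (c * c') X"
    and "real_smult A 1 X = X"
    and "real_smult A c X \<oplus>\<^bsub>\<Gamma> A\<^esub> real_smult A c' X = real_smult A (c + c') X"
    and "real_smult A 0 X = \<zero>\<^bsub>\<Gamma> A\<^esub>"
    and "Y \<in> carrier (\<Gamma> A) \<Longrightarrow>
      real_smult A c (X \<oplus>\<^bsub>\<Gamma> A\<^esub> Y) = real_smult A c X \<oplus>\<^bsub>\<Gamma> A\<^esub> real_smult A c Y"
proof -
  note cl = section_smult_closed[OF A] section_add_closed[OF A] section_zero_closed[OF A]
  note fib = section_in_fibre[OF A]
  have m: "Module.module real_ring (fibre A p)" if "p \<in> points (base A)" for p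
    by (rule vector_bundleD(5)[OF A that])
  show "real_smult A c (real_smult A c' X) = real_smult A (c * c') X"
    by (rule section_eqI[where A = A]; (intro cl X)?; simp add: section_operations module.smult_assoc1[OF m, simplified] fib X)
  show "real_smult A 1 X = X"
    by (rule section_eqI[where A = A]; (intro cl X)?; simp add: section_operations module.smult_one[OF m, simplified] fib X)
  show "real_smult A c X \<oplus>\<^bsub>\<Gamma> A\<^esub> real_smult A c' X = real_smult A (c + c') X"
    by (rule section_eqI[where A = A]; (intro cl X)?; simp add: section_operations module.smult_l_distr[OF m, simplified] fib X)
  show "real_smult A 0 X = \<zero>\<^bsub>\<Gamma> A\<^esub>"
    by (rule section_eqI[where A = A]; (intro cl X)?; simp add: section_operations module.smult_l_null[OF m, simplified] fib X)
  show "real_smult A c (X \<oplus>\<^bsub>\<Gamma> A\<^esub> Y) = real_smult A c X \<oplus>\<^bsub>\<Gamma> A\<^esub> real_smult A c Y"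
    if "Y \<in> carrier (\<Gamma> A)"
    by (rule section_eqI[where A = A]; (intro cl X that)?; simp add: section_operations module.smult_r_distr[OF m, simplified] fib X that)
qed

lemma abelian_group_sections:
  assumes A: "vector_bundle A"
  shows "abelian_group (\<Gamma> A)"
proof (rule abelian_groupI)
  note cl = section_smult_closed[OF A] section_add_closed[OF A] section_zero_closed[OF A]
  note fib = section_in_fibre[OF A]
  have g: "abelian_group (fibre A p)" if "p \<in> points (base A)" for p
    using vector_bundleD(5)[OF A that] by (rule module.axioms(2))
  note gm = abelian_monoid.a_assoc[OF abelian_group.axioms(1)[OF g]]
    abelian_monoid.a_comm[OF abelian_group.axioms(1)[OF g]]
    abelian_monoid.l_zero[OF abelian_group.axioms(1)[OF g]]
  fix X Y Z assume X: "X \<in> carrier (\<Gamma> A)"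
  show "\<zero>\<^bsub>\<Gamma> A\<^esub> \<oplus>\<^bsub>\<Gamma> A\<^esub> X = X"
    by (rule section_eqI[where A = A]; (intro cl X)?; simp add: section_operations gm fib X)
  have "real_smult A (-1) X \<oplus>\<^bsub>\<Gamma> A\<^esub> X = \<zero>\<^bsub>\<Gamma> A\<^esub>"
    using real_smult_simps(3)[OF A X, of "-1" 1] real_smult_simps(2,4)[OF A X] by simp
  then show "\<exists>Y\<in>carrier (\<Gamma> A). Y \<oplus>\<^bsub>\<Gamma> A\<^esub> X = \<zero>\<^bsub>\<Gamma> A\<^esub>"
    using cl(1)[OF X] by blast
  assume Y: "Y \<in> carrier (\<Gamma> A)"
  show "X \<oplus>\<^bsub>\<Gamma> A\<^esub> Y \<in> carrier (\<Gamma> A)" by (rule cl(2)[OF X Y])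
  show "X \<oplus>\<^bsub>\<Gamma> A\<^esub> Y = Y \<oplus>\<^bsub>\<Gamma> A\<^esub> X"
    by (rule section_eqI[where A = A]; (intro cl X Y)?; simp add: section_operations abelian_monoid.a_comm[OF abelian_group.axioms(1)[OF g]] fib X Y)
  assume Z: "Z \<in> carrier (\<Gamma> A)"
  show "(X \<oplus>\<^bsub>\<Gamma> A\<^esub> Y) \<oplus>\<^bsub>\<Gamma> A\<^esub> Z = X \<oplus>\<^bsub>\<Gamma> A\<^esub> (Y \<oplus>\<^bsub>\<Gamma> A\<^esub> Z)"
    by (rule section_eqI[where A = A]; (intro cl X Y Z)?; simp add: section_operations gm(1) fib X Y Z)
qed (rule section_zero_closed[OF A])


section \<open>The induced bracket and the fundamental identity\<close>

lemma (in abelian_monoid) finsum_swap: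
  assumes "finite I" "finite J" "\<And>i j. \<lbrakk>i \<in> I; j \<in> J\<rbrakk> \<Longrightarrow> f i j \<in> carrier G"
  shows "(\<Oplus>i\<in>I. \<Oplus>j\<in>J. f i j) = (\<Oplus>j\<in>J. \<Oplus>i\<in>I. f i j)"
  using assms(1,3)
proof (induction I rule: finite_induct)
  case empty
  then show ?case by simp
next
  case (insert i I)
  have "(\<Oplus>j\<in>J. \<Oplus>i\<in>insert i I. f i j) = (\<Oplus>j\<in>J. f i j \<oplus> (\<Oplus>i\<in>I. f i j))"
    by (rule finsum_cong') (use insert in \<open>auto intro!: finsum_closed\<close>)
  also have "\<dots> = (\<Oplus>j\<in>J. f i j) \<oplus> (\<Oplus>j\<in>J. \<Oplus>i\<in>I. f i j)"
    using insert by (intro finsum_addf) (auto intro!: finsum_closed)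
  also have "\<dots> = (\<Oplus>i\<in>insert i I. \<Oplus>j\<in>J. f i j)"
    using insert by (subst finsum_insert) (auto intro!: finsum_closed)
  finally show ?case ..
qed

lemma (in abelian_monoid) finsum_remove:
  assumes "finite I" "i \<in> I" "f \<in> I \<rightarrow> carrier G"
  shows "finsum G f I = f i \<oplus> finsum G f (I - {i})"
proof -
  have "finsum G f (insert i (I - {i})) = f i \<oplus> finsum G f (I - {i})"
    using assms by (intro finsum_insert) auto
  then show ?thesis using assms(2) by (simp add: insert_absorb)
qed

text \<open>
  Filling the diagonal with zeros reduces this to a rectangular sum.
\<close>

lemma (in abelian_monoid) finsum_swap_off_diagonal:
  assumes "finite I" "\<And>i j. \<lbrakk>i \<in> I; j \<in> I\<rbrakk> \<Longrightarrow> f i j \<in> carrier G"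
  shows "(\<Oplus>i\<in>I. \<Oplus>j\<in>I - {i}. f i j) = (\<Oplus>j\<in>I. \<Oplus>i\<in>I - {j}. f i j)"
proof -
  let ?f = "\<lambda>i j. if i = j then \<zero> else f i j"
  have r: "(\<Oplus>j\<in>I. ?f i j) = (\<Oplus>j\<in>I - {i}. f i j)" "(\<Oplus>j\<in>I. ?f j i) = (\<Oplus>j\<in>I - {i}. f j i)"
    if "i \<in> I" for i
  proof -
    have "(\<Oplus>j\<in>I. ?f i j) = \<zero> \<oplus> (\<Oplus>j\<in>I - {i}. ?f i j)"
      using finsum_remove[OF assms(1) that, of "?f i"] assms that by auto
    also have "\<dots> = (\<Oplus>j\<in>I - {i}. ?f i j)"
      using assms that by (intro l_zero finsum_closed) auto
    also have "\<dots> = (\<Oplus>j\<in>I - {i}. f i j)"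
      by (rule finsum_cong') (use assms that in auto)
    finally show "(\<Oplus>j\<in>I. ?f i j) = (\<Oplus>j\<in>I - {i}. f i j)" .
    have "(\<Oplus>j\<in>I. ?f j i) = \<zero> \<oplus> (\<Oplus>j\<in>I - {i}. ?f j i)"
      using finsum_remove[OF assms(1) that, of "\<lambda>j. ?f j i"] assms that by auto
    also have "\<dots> = (\<Oplus>j\<in>I - {i}. ?f j i)"
      using assms that by (intro l_zero finsum_closed) auto
    also have "\<dots> = (\<Oplus>j\<in>I - {i}. f j i)"
      by (rule finsum_cong') (use assms that in auto)
    finally show "(\<Oplus>j\<in>I. ?f j i) = (\<Oplus>j\<in>I - {i}. f j i)" .
  qed
  have "(\<Oplus>i\<in>I. \<Oplus>j\<in>I - {i}. f i j) = (\<Oplus>i\<in>I. \<Oplus>j\<in>I. ?f i j)"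
    by (rule finsum_cong') (use assms in \<open>auto simp: r intro!: finsum_closed\<close>)
  also have "\<dots> = (\<Oplus>j\<in>I. \<Oplus>i\<in>I. ?f i j)"
    by (rule finsum_swap) (use assms in auto)
  also have "\<dots> = (\<Oplus>j\<in>I. \<Oplus>i\<in>I - {j}. f i j)"
    by (rule finsum_cong') (use assms in \<open>auto simp: r intro!: finsum_closed\<close>)
  finally show ?thesis .
qed

lemma (in abelian_group) additive_finsum:
  assumes h: "\<And>x. x \<in> carrier G \<Longrightarrow> h x \<in> carrier G"
    "\<And>x y. \<lbrakk>x \<in> carrier G; y \<in> carrier G\<rbrakk> \<Longrightarrow> h (x \<oplus> y) = h x \<oplus> h y"
    and "finite I" "f \<in> I \<rightarrow> carrier G"
  shows "h (finsum G f I) = (\<Oplus>i\<in>I. h (f i))"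
  using assms(3,4)
proof (induction I rule: finite_induct)
  case empty
  have "h \<zero> \<oplus> h \<zero> = h \<zero>" using h(2)[of \<zero> \<zero>] by simp
  then show ?case using h(1)[of \<zero>] by (simp add: add.l_cancel_one)
next
  case (insert i I)
  then show ?case by (simp add: h Pi_iff)
qed

lemma (in abelian_group) finsum_diff:
  assumes "finite I" "f \<in> I \<rightarrow> carrier G" "g \<in> I \<rightarrow> carrier G"
  shows "(\<Oplus>i\<in>I. f i \<ominus> g i) = finsum G f I \<ominus> finsum G g I"
proof -
  have "(\<Oplus>i\<in>I. f i \<ominus> g i) = finsum G f I \<oplus> (\<Oplus>i\<in>I. \<ominus> g i)"
    using assms by (auto simp: a_minus_def Pi_iff intro: finsum_addf)
  also have "(\<Oplus>i\<in>I. \<ominus> g i) = \<ominus> finsum G g I"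
    using assms by (subst additive_finsum[where h = "a_inv G"]) (auto simp: minus_add)
  finally show ?thesis by (simp add: a_minus_def)
qed

lemma (in abelian_group) minus_eq_zero_iff:
  assumes "x \<in> carrier G" "y \<in> carrier G"
  shows "x \<ominus> y = \<zero> \<longleftrightarrow> x = y"
proof
  assume "x \<ominus> y = \<zero>"
  then have "x = \<ominus> (\<ominus> y)"
    using assms minus_equality[of x "\<ominus> y"] by (simp add: a_minus_def)
  then show "x = y" using assms by simp
qed (use assms in \<open>simp add: a_minus_def r_neg\<close>)

lemma section_list_iff:
  "Xs \<in> section_lists A m \<longleftrightarrow> length Xs = m \<and> (\<forall>i<m. Xs ! i \<in> carrier (\<Gamma> A))"
  by (auto simp: section_lists_def subset_iff in_set_conv_nth)

lemma length_omit: "\<lbrakk>1 \<le> k; k \<le> length Xs\<rbrakk> \<Longrightarrow> length (omit k Xs) = length Xs - 1"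
  by (simp add: omit_def)

lemma nth_omit:
  "\<lbrakk>1 \<le> k; k \<le> length Xs; i < length Xs - 1\<rbrakk> \<Longrightarrow> omit k Xs ! i = Xs ! (if i + 1 < k then i else Suc i)"
  by (auto simp: omit_def nth_append min_def not_less intro!: arg_cong[of _ _ "(!) Xs"])

lemma omit_section_lists:
  assumes "Xs \<in> section_lists A m" "1 \<le> k" "k \<le> m"
  shows "omit k Xs \<in> section_lists A (m - 1)"
  using assms by (auto simp: section_list_iff length_omit nth_omit)

lemma omit_update_same: "\<lbrakk>1 \<le> k; k \<le> length Xs\<rbrakk> \<Longrightarrow> omit k (Xs[k - 1 := b]) = omit k Xs"
  by (simp add: omit_def)

text \<open>
  The entry at position \<open>i\<close>, counted from 0, of \<open>omit j Xs\<close> comes from position \<open>i\<close> or \<open>i + 1\<close> of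
  \<open>Xs\<close>, according to whether it lies before or after the omitted entry, the \<open>j\<close>-th one counted from 1.
\<close>

lemma omit_update:
  assumes j: "1 \<le> j" "j \<le> length Xs" and i: "i < length Xs - 1"
  shows "omit j (Xs[(if i + 1 < j then i else Suc i) := b]) = (omit j Xs)[i := b]"
  using assms by (intro nth_equalityI) (auto simp: length_omit nth_omit nth_list_update)

locale bundle_with_connection =
  fixes n :: nat and A :: "('m, 'e) bundle_data"
    and \<aa> :: "'m \<Rightarrow> 'e list \<Rightarrow> ('m \<Rightarrow> real) \<Rightarrow> real"
    and D :: "('m \<Rightarrow> 'e) list \<Rightarrow> ('m \<Rightarrow> 'e) \<Rightarrow> 'm \<Rightarrow> 'e"
  assumes n_ge_2: "n \<ge> 2"
    and anchored: "n_anchored_bundle n A \<aa>"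
    and connection: "n_connection n A \<aa> D"
begin

lemma vector_bundle: "vector_bundle A"
  using anchored by (simp add: n_anchored_bundle_def)

sublocale S: abelian_group "\<Gamma> A"
  by (rule abelian_group_sections[OF vector_bundle])

text \<open>
  All signs are kept as powers of \<open>-1\<close>, so that they can be combined by adding exponents and compared
  by parity.
\<close>

abbreviation sign :: "nat \<Rightarrow> ('m \<Rightarrow> 'e) \<Rightarrow> 'm \<Rightarrow> 'e" where
  "sign k X \<equiv> real_smult A ((-1) ^ k) X"

abbreviation bracket :: "('m \<Rightarrow> 'e) list \<Rightarrow> 'm \<Rightarrow> 'e" where
  "bracket \<equiv> n_bracket n A D"

lemma
  assumes "Xs \<in> section_lists A (n - 1)" "X \<in> carrier (\<Gamma> A)"
  shows D_closed: "D Xs X \<in> carrier (\<Gamma> A)"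
    and D_add: "Y \<in> carrier (\<Gamma> A) \<Longrightarrow> D Xs (X \<oplus>\<^bsub>\<Gamma> A\<^esub> Y) = D Xs X \<oplus>\<^bsub>\<Gamma> A\<^esub> D Xs Y"
    and D_smult: "D Xs (real_smult A c X) = real_smult A c (D Xs X)"
    and D_swap: "\<lbrakk>i < j; j < n - 1\<rbrakk> \<Longrightarrow> D (swap i j Xs) X = \<ominus>\<^bsub>\<Gamma> A\<^esub> D Xs X"
  using connection assms unfolding n_connection_def by blast+

lemmas smult_closed = section_smult_closed[OF vector_bundle]

lemma sign_sign: "X \<in> carrier (\<Gamma> A) \<Longrightarrow> sign j (sign k X) = sign (j + k) X"
  by (simp add: real_smult_simps(1)[OF vector_bundle] power_add)

lemma sign_even: "\<lbrakk>X \<in> carrier (\<Gamma> A); even k\<rbrakk> \<Longrightarrow> sign k X = X"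
  by (simp add: real_smult_simps(2)[OF vector_bundle])

lemma sign_cong: "even j = even k \<Longrightarrow> sign j X = sign k X"
  by (simp add: uminus_power_if)

lemma uminus_eq_sign:
  assumes X: "X \<in> carrier (\<Gamma> A)"
  shows "\<ominus>\<^bsub>\<Gamma> A\<^esub> X = sign 1 X"
proof -
  have "sign 1 X \<oplus>\<^bsub>\<Gamma> A\<^esub> X = \<zero>\<^bsub>\<Gamma> A\<^esub>"
    using real_smult_simps(3)[OF vector_bundle X, of "-1" 1] real_smult_simps(2,4)[OF vector_bundle X] by simp
  then show ?thesis using S.minus_equality smult_closed X by blast
qed

lemma sign_add:
  "\<lbrakk>X \<in> carrier (\<Gamma> A); Y \<in> carrier (\<Gamma> A)\<rbrakk> \<Longrightarrow> sign k (X \<oplus>\<^bsub>\<Gamma> A\<^esub> Y) = sign k X \<oplus>\<^bsub>\<Gamma> A\<^esub> sign k Y"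
  by (rule real_smult_simps(5)[OF vector_bundle])

lemma sign_uminus: "X \<in> carrier (\<Gamma> A) \<Longrightarrow> sign k (\<ominus>\<^bsub>\<Gamma> A\<^esub> X) = \<ominus>\<^bsub>\<Gamma> A\<^esub> sign k X"
  by (simp add: uminus_eq_sign smult_closed sign_sign[of X k 1, simplified]
      sign_sign[of X 1 k, simplified])

lemma sign_minus:
  "\<lbrakk>X \<in> carrier (\<Gamma> A); Y \<in> carrier (\<Gamma> A)\<rbrakk> \<Longrightarrow> sign k (X \<ominus>\<^bsub>\<Gamma> A\<^esub> Y) = sign k X \<ominus>\<^bsub>\<Gamma> A\<^esub> sign k Y"
  by (simp add: a_minus_def sign_add sign_uminus)

lemma sign_finsum:
  assumes "finite I" "f \<in> I \<rightarrow> carrier (\<Gamma> A)"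
  shows "sign k (finsum (\<Gamma> A) f I) = (\<Oplus>\<^bsub>\<Gamma> A\<^esub>i\<in>I. sign k (f i))"
  by (rule S.additive_finsum) (use assms smult_closed sign_add in auto)

lemma D_finsum:
  assumes "Xs \<in> section_lists A (n - 1)" "finite I" "f \<in> I \<rightarrow> carrier (\<Gamma> A)"
  shows "D Xs (finsum (\<Gamma> A) f I) = (\<Oplus>\<^bsub>\<Gamma> A\<^esub>i\<in>I. D Xs (f i))"
  by (rule S.additive_finsum) (use assms D_closed D_add in auto)

text \<open>
  Each factor that \<open>b\<close> passes costs one adjacent transposition.
\<close>

lemma D_move_to_front:
  assumes "Ws @ b # Vs \<in> section_lists A (n - 1)" "X \<in> carrier (\<Gamma> A)"
  shows "D (Ws @ b # Vs) X = sign (length Ws) (D (b # Ws @ Vs) X)"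
  using assms(1)
proof (induction Ws arbitrary: Vs rule: rev_induct)
  case Nil
  then show ?case using assms(2) by (simp add: sign_even[of _ 0, simplified] D_closed)
next
  case (snoc w Ws)
  let ?m = "length Ws"
  have l: "Ws @ b # w # Vs \<in> section_lists A (n - 1)" "b # Ws @ w # Vs \<in> section_lists A (n - 1)"
    using snoc.prems by (auto simp: section_lists_def)
  have "Ws @ w # b # Vs = swap ?m (Suc ?m) (Ws @ b # w # Vs)"
    by (simp add: swap_def list_update_append nth_append)
  moreover have "Suc ?m < n - 1" using snoc.prems by (auto simp: section_lists_def)
  ultimately have "D (Ws @ w # b # Vs) X = \<ominus>\<^bsub>\<Gamma> A\<^esub> D (Ws @ b # w # Vs) X"
    using D_swap[OF l(1) assms(2), of ?m "Suc ?m"] by simp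
  also have "\<dots> = \<ominus>\<^bsub>\<Gamma> A\<^esub> sign ?m (D (b # Ws @ w # Vs) X)"
    using snoc.IH[OF l(1)] by simp
  also have "\<dots> = sign 1 (sign ?m (D (b # Ws @ w # Vs) X))"
    by (rule uminus_eq_sign) (intro smult_closed D_closed l assms(2))
  also have "\<dots> = sign (Suc ?m) (D (b # Ws @ w # Vs) X)"
    by (subst sign_sign) (intro D_closed l assms(2), simp)
  finally show ?case by simp
qed

lemma bracket_closed:
  assumes "Xs \<in> section_lists A n"
  shows "bracket Xs \<in> carrier (\<Gamma> A)"
  unfolding n_bracket_def
proof (intro S.finsum_closed Pi_I smult_closed D_closed)
  fix k assume "k \<in> {1..n}"
  then show "omit k Xs \<in> section_lists A (n - 1)" "Xs ! (k - 1) \<in> carrier (\<Gamma> A)"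
    using omit_section_lists[OF assms, of k] assms by (auto simp: section_list_iff)
qed

lemma snoc_section_list:
  assumes "Xs \<in> section_lists A (n - 1)" "B \<in> carrier (\<Gamma> A)"
  shows "Xs @ [B] \<in> section_lists A n"
  using assms n_ge_2 by (auto simp: section_lists_def)

lemma omit_snoc_section_list:
  assumes "Xs \<in> section_lists A (n - 1)" "B \<in> carrier (\<Gamma> A)" "l \<in> {1..n - 1}"
  shows "omit l Xs @ [B] \<in> section_lists A (n - 1)" "B # omit l Xs \<in> section_lists A (n - 1)"
    "Xs ! (l - 1) \<in> carrier (\<Gamma> A)"
  using omit_section_lists[OF assms(1), of l] assms n_ge_2 by (auto simp: section_lists_def)

text \<open>
  The last term of the sum has sign \<open>(-1) ^ (2 * n)\<close> and differentiates \<open>B\<close>; in all others \<open>B\<close> is the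
  last factor.
\<close>

lemma bracket_snoc:
  assumes X: "Xs \<in> section_lists A (n - 1)" and B: "B \<in> carrier (\<Gamma> A)"
  shows "bracket (Xs @ [B]) = D Xs B \<oplus>\<^bsub>\<Gamma> A\<^esub>
           (\<Oplus>\<^bsub>\<Gamma> A\<^esub>l\<in>{1..n - 1}. sign (n + l) (D (omit l Xs @ [B]) (Xs ! (l - 1))))"
proof -
  have len: "length Xs = n - 1" using X by (simp add: section_list_iff)
  let ?f = "\<lambda>k. sign (n + k) (D (omit k (Xs @ [B])) ((Xs @ [B]) ! (k - 1)))"
  have low: "?f l = sign (n + l) (D (omit l Xs @ [B]) (Xs ! (l - 1)))" if "l \<in> {1..n - 1}" for l
    using that len by (auto simp: omit_def nth_append)
  have top: "?f n = D Xs B"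
    using len n_ge_2 real_smult_simps(2)[OF vector_bundle D_closed[OF X B]]
    by (simp add: omit_def nth_append)
  have cl: "?f l \<in> carrier (\<Gamma> A)" if "l \<in> {1..n - 1}" for l
    unfolding low[OF that] using omit_snoc_section_list[OF X B that] by (intro smult_closed D_closed)
  have cl_top: "?f n \<in> carrier (\<Gamma> A)" unfolding top by (rule D_closed[OF X B])
  have "{1..n} = insert n {1..n - 1}" using n_ge_2 by auto
  then have "bracket (Xs @ [B]) = ?f n \<oplus>\<^bsub>\<Gamma> A\<^esub> (\<Oplus>\<^bsub>\<Gamma> A\<^esub>l\<in>{1..n - 1}. ?f l)"
    unfolding n_bracket_def using n_ge_2 cl cl_top by (simp only:) (subst S.finsum_insert; auto)
  also have "(\<Oplus>\<^bsub>\<Gamma> A\<^esub>l\<in>{1..n - 1}. ?f l) =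
      (\<Oplus>\<^bsub>\<Gamma> A\<^esub>l\<in>{1..n - 1}. sign (n + l) (D (omit l Xs @ [B]) (Xs ! (l - 1))))"
    by (rule S.finsum_cong') (use low cl in auto)
  finally show ?thesis unfolding top .
qed

text \<open>
  In this form the terms have the shape that they have in the Bianchi identity: moving \<open>B\<close> to the
  front contributes \<open>(-1) ^ (n - 2)\<close>, which cancels the sign \<open>(-1) ^ n\<close>.
\<close>

lemma bracket_snoc_front:
  assumes X: "Xs \<in> section_lists A (n - 1)" and B: "B \<in> carrier (\<Gamma> A)"
  shows "bracket (Xs @ [B]) = D Xs B \<oplus>\<^bsub>\<Gamma> A\<^esub>
           (\<Oplus>\<^bsub>\<Gamma> A\<^esub>l\<in>{1..n - 1}. sign l (D (B # omit l Xs) (Xs ! (l - 1))))"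
proof -
  have "sign (n + l) (D (omit l Xs @ [B]) (Xs ! (l - 1))) = sign l (D (B # omit l Xs) (Xs ! (l - 1)))"
    if l: "l \<in> {1..n - 1}" for l
  proof -
    note m = omit_snoc_section_list[OF X B l]
    have "length (omit l Xs) = n - 2"
      using l X by (simp add: length_omit section_list_iff)
    then have "D (omit l Xs @ [B]) (Xs ! (l - 1)) = sign (n - 2) (D (B # omit l Xs) (Xs ! (l - 1)))"
      using D_move_to_front[of "omit l Xs" B "[]"] m by simp
    then have "sign (n + l) (D (omit l Xs @ [B]) (Xs ! (l - 1))) =
        sign (n + l + (n - 2)) (D (B # omit l Xs) (Xs ! (l - 1)))"
      using m by (simp only: sign_sign D_closed)
    also have "\<dots> = sign l (D (B # omit l Xs) (Xs ! (l - 1)))"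
      using n_ge_2 by (intro sign_cong) auto
    finally show ?thesis .
  qed
  then have "(\<Oplus>\<^bsub>\<Gamma> A\<^esub>l\<in>{1..n - 1}. sign (n + l) (D (omit l Xs @ [B]) (Xs ! (l - 1)))) =
      (\<Oplus>\<^bsub>\<Gamma> A\<^esub>l\<in>{1..n - 1}. sign l (D (B # omit l Xs) (Xs ! (l - 1))))"
    using omit_snoc_section_list[OF X B] by (intro S.finsum_cong') (auto intro!: smult_closed D_closed)
  then show ?thesis using bracket_snoc[OF X B] by simp
qed

text \<open>
  The two parts play different roles in the fundamental identity: the term that differentiates \<open>b\<close> is
  to be expanded further, while the terms in which \<open>b\<close> is a factor belong to brackets of
  \<open>(n - 1)\<close>-vectors.
\<close>

lemma bracket_update:
  assumes Y: "Ys \<in> section_lists A n" and k: "k \<in> {1..n}" and b: "b \<in> carrier (\<Gamma> A)"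
  shows "bracket (Ys[k - 1 := b]) = sign (n + k) (D (omit k Ys) b) \<oplus>\<^bsub>\<Gamma> A\<^esub>
           (\<Oplus>\<^bsub>\<Gamma> A\<^esub>j\<in>{1..n} - {k}. sign (n + j) (D (omit j (Ys[k - 1 := b])) (Ys ! (j - 1))))"
proof -
  let ?f = "\<lambda>j. sign (n + j) (D (omit j (Ys[k - 1 := b])) (Ys[k - 1 := b] ! (j - 1)))"
  have len: "length Ys = n" using Y by (simp add: section_list_iff)
  have Yb: "Ys[k - 1 := b] \<in> section_lists A n"
    using Y b k by (auto simp: section_list_iff nth_list_update)
  have cl: "?f j \<in> carrier (\<Gamma> A)" if "j \<in> {1..n}" for j
    using omit_section_lists[OF Yb, of j] Yb that
    by (intro smult_closed D_closed) (auto simp: section_list_iff)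
  have "bracket (Ys[k - 1 := b]) = ?f k \<oplus>\<^bsub>\<Gamma> A\<^esub> (\<Oplus>\<^bsub>\<Gamma> A\<^esub>j\<in>{1..n} - {k}. ?f j)"
    unfolding n_bracket_def by (rule S.finsum_remove) (use k cl in auto)
  also have "?f k = sign (n + k) (D (omit k Ys) b)"
  proof -
    have "k - 1 < length Ys" using k len by auto
    then show ?thesis using k len omit_update_same[of k Ys b] by simp
  qed
  also have "(\<Oplus>\<^bsub>\<Gamma> A\<^esub>j\<in>{1..n} - {k}. ?f j) =
      (\<Oplus>\<^bsub>\<Gamma> A\<^esub>j\<in>{1..n} - {k}. sign (n + j) (D (omit j (Ys[k - 1 := b])) (Ys ! (j - 1))))"
  proof (rule S.finsum_cong')
    have eq: "?f j = sign (n + j) (D (omit j (Ys[k - 1 := b])) (Ys ! (j - 1)))" if "j \<in> {1..n} - {k}" for j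
    proof -
      have "k - 1 \<noteq> j - 1" using that k by auto
      then show ?thesis by simp
    qed
    then show "\<And>j. j \<in> {1..n} - {k} \<Longrightarrow> ?f j = sign (n + j) (D (omit j (Ys[k - 1 := b])) (Ys ! (j - 1)))" .
    show "(\<lambda>j. sign (n + j) (D (omit j (Ys[k - 1 := b])) (Ys ! (j - 1)))) \<in> {1..n} - {k} \<rightarrow> carrier (\<Gamma> A)"
      using cl eq by fastforce
  qed simp
  finally show ?thesis .
qed

text \<open>
  The bracket of \<open>(n - 1)\<close>-vectors replaces the entries of \<open>Y\<^sub>1 \<and> \<dots> \<and> Y\<^sub>n\<close> without \<open>Y\<^sub>j\<close> one after the
  other.  Indexed by the positions in the full list, these are the positions other than \<open>j\<close>; the same
  terms arise when an entry of the full list is replaced and the \<open>j\<close>-th one is omitted afterwards.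
\<close>

lemma connection_sum_wedge_bracket_omit:
  assumes X: "Xs \<in> section_lists A (n - 1)" and Y: "Ys \<in> section_lists A n" and j: "j \<in> {1..n}"
    and Z: "Z \<in> carrier (\<Gamma> A)"
  shows "connection_sum A D (wedge_bracket n A D Xs (omit j Ys)) Z =
         (\<Oplus>\<^bsub>\<Gamma> A\<^esub>k\<in>{1..n} - {j}. D (omit j (Ys[k - 1 := bracket (Xs @ [Ys ! (k - 1)])])) Z)"
    and "(\<lambda>k. D (omit j (Ys[k - 1 := bracket (Xs @ [Ys ! (k - 1)])])) Z) \<in> {1..n} - {j} \<rightarrow> carrier (\<Gamma> A)"
proof -
  let ?g = "\<lambda>k. D (omit j (Ys[k - 1 := bracket (Xs @ [Ys ! (k - 1)])])) Z"
  \<comment> \<open>The position in \<open>Ys\<close>, counted from 1, of the entry at position \<open>i\<close>, counted from 0, of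
    \<open>omit j Ys\<close>.\<close>
  let ?skip = "\<lambda>i. if i + 1 < j then i + 1 else i + 2"
  have len: "length Ys = n" using Y by (simp add: section_list_iff)
  show cl: "?g \<in> {1..n} - {j} \<rightarrow> carrier (\<Gamma> A)"
  proof
    fix k assume k: "k \<in> {1..n} - {j}"
    then have "bracket (Xs @ [Ys ! (k - 1)]) \<in> carrier (\<Gamma> A)"
      using Y by (intro bracket_closed snoc_section_list[OF X]) (auto simp: section_list_iff)
    then have "Ys[k - 1 := bracket (Xs @ [Ys ! (k - 1)])] \<in> section_lists A n"
      using Y k by (auto simp: section_list_iff nth_list_update)
    then show "?g k \<in> carrier (\<Gamma> A)"
      using j Z by (intro D_closed omit_section_lists) auto
  qed
  have inj: "inj_on ?skip {..<n - 1}" by (auto simp: inj_on_def split: if_splits)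
  have im: "?skip ` {..<n - 1} = {1..n} - {j}"
  proof
    show "?skip ` {..<n - 1} \<subseteq> {1..n} - {j}" using j by auto
    show "{1..n} - {j} \<subseteq> ?skip ` {..<n - 1}"
    proof
      fix k assume k: "k \<in> {1..n} - {j}"
      show "k \<in> ?skip ` {..<n - 1}"
      proof (cases "k < j")
        case True
        then show ?thesis using k j by (intro image_eqI[of _ _ "k - 1"]) auto
      next
        case False
        then show ?thesis using k j by (intro image_eqI[of _ _ "k - 2"]) auto
      qed
    qed
  qed
  have wb: "D (wedge_bracket n A D Xs (omit j Ys) ! i) Z = ?g (?skip i)" if i: "i < n - 1" for i
  proof -
    let ?s = "if i + 1 < j then i else Suc i"
    have "wedge_bracket n A D Xs (omit j Ys) ! i = (omit j Ys)[i := bracket (Xs @ [omit j Ys ! i])]"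
      using i by (simp add: wedge_bracket_def)
    also have "omit j Ys ! i = Ys ! ?s"
      using j i len by (intro nth_omit) auto
    also have "(omit j Ys)[i := bracket (Xs @ [Ys ! ?s])] = omit j (Ys[?s := bracket (Xs @ [Ys ! ?s])])"
      using j i len by (intro omit_update[symmetric]) auto
    finally have "wedge_bracket n A D Xs (omit j Ys) ! i = omit j (Ys[?s := bracket (Xs @ [Ys ! ?s])])" .
    moreover have "?skip i - 1 = ?s" by simp
    ultimately show ?thesis by (simp only:)
  qed
  have "connection_sum A D (wedge_bracket n A D Xs (omit j Ys)) Z = (\<Oplus>\<^bsub>\<Gamma> A\<^esub>i\<in>{..<n - 1}. ?g (?skip i))"
    unfolding connection_sum_def
  proof (rule S.finsum_cong')
    show "{..<length (wedge_bracket n A D Xs (omit j Ys))} = {..<n - 1}"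
      by (simp add: wedge_bracket_def)
    show "(\<lambda>i. ?g (?skip i)) \<in> {..<n - 1} \<rightarrow> carrier (\<Gamma> A)"
      using cl im by (auto simp only: Pi_iff)
  qed (use wb in auto)
  also have "\<dots> = (\<Oplus>\<^bsub>\<Gamma> A\<^esub>k\<in>{1..n} - {j}. ?g k)"
    using S.finsum_reindex[of ?g ?skip "{..<n - 1}"] cl inj unfolding im by simp
  finally show "connection_sum A D (wedge_bracket n A D Xs (omit j Ys)) Z = (\<Oplus>\<^bsub>\<Gamma> A\<^esub>k\<in>{1..n} - {j}. ?g k)" .
qed

text \<open>
  Both sides are written with five sums: \<open>P\<close>, \<open>R\<close> and \<open>C\<close> collect the three kinds of terms of the
  curvatures, \<open>Q\<close> is the second sum of the Bianchi identity and \<open>T\<close> its double sum.  The fundamental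
  identity becomes \<open>P + Q = R + T + C\<close> and the Bianchi identity \<open>P - R - C + Q - T = 0\<close>.
\<close>

lemma fundamental_identity_iff_Bianchi:
  assumes X: "Xs \<in> section_lists A (n - 1)" and Y: "Ys \<in> section_lists A n"
  shows "bracket (Xs @ [bracket Ys]) =
        (\<Oplus>\<^bsub>\<Gamma> A\<^esub>k\<in>{1..n}. bracket (Ys[k - 1 := bracket (Xs @ [Ys ! (k - 1)])])) \<longleftrightarrow>
        (\<Oplus>\<^bsub>\<Gamma> A\<^esub>k\<in>{1..n}. sign (k + n) (n_curvature n A D Xs (omit k Ys) (Ys ! (k - 1))))
        \<oplus>\<^bsub>\<Gamma> A\<^esub>
        (\<Oplus>\<^bsub>\<Gamma> A\<^esub>l\<in>{1..n - 1}. sign l (D (bracket Ys # omit l Xs) (Xs ! (l - 1))))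
        \<ominus>\<^bsub>\<Gamma> A\<^esub>
        (\<Oplus>\<^bsub>\<Gamma> A\<^esub>l\<in>{1..n - 1}. \<Oplus>\<^bsub>\<Gamma> A\<^esub>k\<in>{1..n}.
           sign (k + l) (D (omit k Ys) (D (omit l Xs @ [Ys ! (k - 1)]) (Xs ! (l - 1)))))
        = \<zero>\<^bsub>\<Gamma> A\<^esub>"
proof -
  define b where "b k = bracket (Xs @ [Ys ! (k - 1)])" for k
  define p where "p k = D Xs (D (omit k Ys) (Ys ! (k - 1)))" for k
  define r where "r k = D (omit k Ys) (D Xs (Ys ! (k - 1)))" for k
  define c where "c k = connection_sum A D (wedge_bracket n A D Xs (omit k Ys)) (Ys ! (k - 1))" for k
  define s where "s k l = D (omit k Ys) (D (omit l Xs @ [Ys ! (k - 1)]) (Xs ! (l - 1)))" for k l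
  define t where "t k j = D (omit j (Ys[k - 1 := b k])) (Ys ! (j - 1))" for k j
  let ?sum = "\<lambda>f. \<Oplus>\<^bsub>\<Gamma> A\<^esub>k\<in>{1..n}. sign (n + k) (f k)"
  define P where "P = ?sum p"
  define R where "R = ?sum r"
  define C where "C = ?sum c"
  define Q where "Q = (\<Oplus>\<^bsub>\<Gamma> A\<^esub>l\<in>{1..n - 1}. sign l (D (bracket Ys # omit l Xs) (Xs ! (l - 1))))"
  define T where "T = (\<Oplus>\<^bsub>\<Gamma> A\<^esub>l\<in>{1..n - 1}. \<Oplus>\<^bsub>\<Gamma> A\<^esub>k\<in>{1..n}. sign (k + l) (s k l))"

  have Yk: "Ys ! (k - 1) \<in> carrier (\<Gamma> A)" "omit k Ys \<in> section_lists A (n - 1)" if "k \<in> {1..n}" for k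
    using Y omit_section_lists[OF Y, of k] that by (auto simp: section_list_iff)
  have B: "bracket Ys \<in> carrier (\<Gamma> A)" by (rule bracket_closed[OF Y])
  have b: "b k \<in> carrier (\<Gamma> A)" if "k \<in> {1..n}" for k
    unfolding b_def by (intro bracket_closed snoc_section_list[OF X] Yk that)
  have p: "p k \<in> carrier (\<Gamma> A)" and r: "r k \<in> carrier (\<Gamma> A)" if "k \<in> {1..n}" for k
    unfolding p_def r_def using X Yk[OF that] by (auto intro!: D_closed)
  have s: "s k l \<in> carrier (\<Gamma> A)" "D (omit l Xs @ [Ys ! (k - 1)]) (Xs ! (l - 1)) \<in> carrier (\<Gamma> A)"
    if "k \<in> {1..n}" "l \<in> {1..n - 1}" for k l
    unfolding s_def using omit_snoc_section_list[OF X Yk(1)[OF that(1)] that(2)] Yk(2)[OF that(1)]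
    by (auto intro!: D_closed)
  have t: "t k j \<in> carrier (\<Gamma> A)" if "k \<in> {1..n}" "j \<in> {1..n}" for k j
  proof -
    have "Ys[k - 1 := b k] \<in> section_lists A n"
      using Y b[OF that(1)] that(1) by (auto simp: section_list_iff nth_list_update)
    then show ?thesis
      unfolding t_def using that(2) Yk(1)[OF that(2)] by (intro D_closed omit_section_lists) auto
  qed
  have c_eq: "c j = (\<Oplus>\<^bsub>\<Gamma> A\<^esub>k\<in>{1..n} - {j}. t k j)" if "j \<in> {1..n}" for j
    unfolding c_def t_def b_def by (rule connection_sum_wedge_bracket_omit(1)[OF X Y that Yk(1)[OF that]])
  have c: "c k \<in> carrier (\<Gamma> A)" if "k \<in> {1..n}" for k
    unfolding c_eq[OF that] using t that by (auto intro!: S.finsum_closed)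
  have Q: "Q \<in> carrier (\<Gamma> A)"
    unfolding Q_def using omit_snoc_section_list[OF X B] by (auto intro!: S.finsum_closed smult_closed D_closed)
  have PRCT: "P \<in> carrier (\<Gamma> A)" "R \<in> carrier (\<Gamma> A)" "C \<in> carrier (\<Gamma> A)" "T \<in> carrier (\<Gamma> A)"
    unfolding P_def R_def C_def T_def using p r c s by (auto intro!: S.finsum_closed smult_closed)

  have "D Xs (bracket Ys) = P"
  proof -
    have cl: "(\<lambda>k. sign (n + k) (D (omit k Ys) (Ys ! (k - 1)))) \<in> {1..n} \<rightarrow> carrier (\<Gamma> A)"
      using Yk by (auto intro!: smult_closed D_closed)
    have "D Xs (bracket Ys) = (\<Oplus>\<^bsub>\<Gamma> A\<^esub>k\<in>{1..n}. D Xs (sign (n + k) (D (omit k Ys) (Ys ! (k - 1)))))"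
      unfolding n_bracket_def by (rule D_finsum[OF X _ cl]) simp
    also have "\<dots> = P"
      unfolding P_def p_def[symmetric]
      by (rule S.finsum_cong') (use p Yk X in \<open>auto simp: D_smult D_closed p_def intro!: smult_closed\<close>)
    finally show ?thesis .
  qed
  then have L: "bracket (Xs @ [bracket Ys]) = P \<oplus>\<^bsub>\<Gamma> A\<^esub> Q"
    using bracket_snoc_front[OF X B] by (simp add: Q_def)

  have Db: "sign (n + k) (D (omit k Ys) (b k)) =
      sign (n + k) (r k) \<oplus>\<^bsub>\<Gamma> A\<^esub> (\<Oplus>\<^bsub>\<Gamma> A\<^esub>l\<in>{1..n - 1}. sign (k + l) (s k l))" if k: "k \<in> {1..n}" for k
  proof -
    note Yk = Yk[OF k]
    let ?v = "\<lambda>l. D (omit l Xs @ [Ys ! (k - 1)]) (Xs ! (l - 1))"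
    have v: "(\<lambda>l. sign (n + l) (?v l)) \<in> {1..n - 1} \<rightarrow> carrier (\<Gamma> A)"
      using s(2)[OF k] smult_closed by auto
    have "D (omit k Ys) (b k) = r k \<oplus>\<^bsub>\<Gamma> A\<^esub> D (omit k Ys) (\<Oplus>\<^bsub>\<Gamma> A\<^esub>l\<in>{1..n - 1}. sign (n + l) (?v l))"
      unfolding b_def bracket_snoc[OF X Yk(1)] r_def
      by (intro D_add Yk D_closed X S.finsum_closed v)
    also have "D (omit k Ys) (\<Oplus>\<^bsub>\<Gamma> A\<^esub>l\<in>{1..n - 1}. sign (n + l) (?v l)) =
        (\<Oplus>\<^bsub>\<Gamma> A\<^esub>l\<in>{1..n - 1}. D (omit k Ys) (sign (n + l) (?v l)))"
      by (rule D_finsum[OF Yk(2) _ v]) simp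
    also have "\<dots> = (\<Oplus>\<^bsub>\<Gamma> A\<^esub>l\<in>{1..n - 1}. sign (n + l) (s k l))"
    proof (rule S.finsum_cong')
      show "D (omit k Ys) (sign (n + l) (?v l)) = sign (n + l) (s k l)" if "l \<in> {1..n - 1}" for l
        unfolding s_def by (rule D_smult[OF Yk(2) s(2)[OF k that]])
    qed (use s(1)[OF k] smult_closed in auto)
    finally have "sign (n + k) (D (omit k Ys) (b k)) = sign (n + k) (r k) \<oplus>\<^bsub>\<Gamma> A\<^esub>
        sign (n + k) (\<Oplus>\<^bsub>\<Gamma> A\<^esub>l\<in>{1..n - 1}. sign (n + l) (s k l))"
      using r[OF k] s[OF k] by (simp add: sign_add smult_closed)
    also have "sign (n + k) (\<Oplus>\<^bsub>\<Gamma> A\<^esub>l\<in>{1..n - 1}. sign (n + l) (s k l)) =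
        (\<Oplus>\<^bsub>\<Gamma> A\<^esub>l\<in>{1..n - 1}. sign (n + k) (sign (n + l) (s k l)))"
      by (rule sign_finsum) (use s(1)[OF k] smult_closed in auto)
    also have "\<dots> = (\<Oplus>\<^bsub>\<Gamma> A\<^esub>l\<in>{1..n - 1}. sign (k + l) (s k l))"
    proof (rule S.finsum_cong')
      fix l assume l: "l \<in> {1..n - 1}"
      have "sign (n + k) (sign (n + l) (s k l)) = sign (n + k + (n + l)) (s k l)"
        by (rule sign_sign[OF s(1)[OF k l]])
      also have "\<dots> = sign (k + l) (s k l)" by (rule sign_cong) presburger
      finally show "sign (n + k) (sign (n + l) (s k l)) = sign (k + l) (s k l)" .
    qed (use s(1)[OF k] smult_closed in auto)
    finally show ?thesis .
  qed

  have "(\<Oplus>\<^bsub>\<Gamma> A\<^esub>k\<in>{1..n}. sign (n + k) (D (omit k Ys) (b k))) =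
      (\<Oplus>\<^bsub>\<Gamma> A\<^esub>k\<in>{1..n}. sign (n + k) (r k) \<oplus>\<^bsub>\<Gamma> A\<^esub> (\<Oplus>\<^bsub>\<Gamma> A\<^esub>l\<in>{1..n - 1}. sign (k + l) (s k l)))"
    by (rule S.finsum_cong') (use Db r s smult_closed in \<open>auto intro!: S.a_closed S.finsum_closed\<close>)
  also have "\<dots> = R \<oplus>\<^bsub>\<Gamma> A\<^esub> (\<Oplus>\<^bsub>\<Gamma> A\<^esub>k\<in>{1..n}. \<Oplus>\<^bsub>\<Gamma> A\<^esub>l\<in>{1..n - 1}. sign (k + l) (s k l))"
    unfolding R_def by (rule S.finsum_addf) (use r s smult_closed in \<open>auto intro!: S.finsum_closed\<close>)
  also have "(\<Oplus>\<^bsub>\<Gamma> A\<^esub>k\<in>{1..n}. \<Oplus>\<^bsub>\<Gamma> A\<^esub>l\<in>{1..n - 1}. sign (k + l) (s k l)) = T"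
    unfolding T_def by (rule S.finsum_swap) (use s smult_closed in auto)
  finally have RT: "(\<Oplus>\<^bsub>\<Gamma> A\<^esub>k\<in>{1..n}. sign (n + k) (D (omit k Ys) (b k))) = R \<oplus>\<^bsub>\<Gamma> A\<^esub> T" .

  \<comment> \<open>The terms with \<open>b k\<close> as a factor, collected by the differentiated \<open>Y\<^sub>j\<close>.\<close>
  have "(\<Oplus>\<^bsub>\<Gamma> A\<^esub>k\<in>{1..n}. \<Oplus>\<^bsub>\<Gamma> A\<^esub>j\<in>{1..n} - {k}. sign (n + j) (t k j)) =
      (\<Oplus>\<^bsub>\<Gamma> A\<^esub>j\<in>{1..n}. \<Oplus>\<^bsub>\<Gamma> A\<^esub>k\<in>{1..n} - {j}. sign (n + j) (t k j))"
    by (rule S.finsum_swap_off_diagonal) (use t smult_closed in auto)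
  also have "\<dots> = C"
    unfolding C_def
  proof (rule S.finsum_cong')
    fix j assume j: "j \<in> {1..n}"
    show "(\<Oplus>\<^bsub>\<Gamma> A\<^esub>k\<in>{1..n} - {j}. sign (n + j) (t k j)) = sign (n + j) (c j)"
      unfolding c_eq[OF j] by (rule sign_finsum[symmetric]) (use t j in auto)
  qed (use c smult_closed in auto)
  finally have CC: "(\<Oplus>\<^bsub>\<Gamma> A\<^esub>k\<in>{1..n}. \<Oplus>\<^bsub>\<Gamma> A\<^esub>j\<in>{1..n} - {k}. sign (n + j) (t k j)) = C" .

  have "(\<Oplus>\<^bsub>\<Gamma> A\<^esub>k\<in>{1..n}. bracket (Ys[k - 1 := b k])) =
      (\<Oplus>\<^bsub>\<Gamma> A\<^esub>k\<in>{1..n}. sign (n + k) (D (omit k Ys) (b k)) \<oplus>\<^bsub>\<Gamma> A\<^esub>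
         (\<Oplus>\<^bsub>\<Gamma> A\<^esub>j\<in>{1..n} - {k}. sign (n + j) (t k j)))"
  proof (rule S.finsum_cong')
    show "bracket (Ys[k - 1 := b k]) = sign (n + k) (D (omit k Ys) (b k)) \<oplus>\<^bsub>\<Gamma> A\<^esub>
        (\<Oplus>\<^bsub>\<Gamma> A\<^esub>j\<in>{1..n} - {k}. sign (n + j) (t k j))" if "k \<in> {1..n}" for k
      unfolding t_def by (rule bracket_update[OF Y that b[OF that]])
  qed (use b t Yk in \<open>auto intro!: S.a_closed S.finsum_closed smult_closed D_closed\<close>)
  also have "\<dots> = R \<oplus>\<^bsub>\<Gamma> A\<^esub> T \<oplus>\<^bsub>\<Gamma> A\<^esub> C"
    unfolding RT[symmetric] CC[symmetric]
    by (rule S.finsum_addf) (use b t Yk in \<open>auto intro!: S.finsum_closed smult_closed D_closed\<close>)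
  finally have FR: "(\<Oplus>\<^bsub>\<Gamma> A\<^esub>k\<in>{1..n}. bracket (Ys[k - 1 := b k])) = R \<oplus>\<^bsub>\<Gamma> A\<^esub> T \<oplus>\<^bsub>\<Gamma> A\<^esub> C" .

  have "(\<Oplus>\<^bsub>\<Gamma> A\<^esub>k\<in>{1..n}. sign (k + n) (n_curvature n A D Xs (omit k Ys) (Ys ! (k - 1)))) =
      (\<Oplus>\<^bsub>\<Gamma> A\<^esub>k\<in>{1..n}. (sign (n + k) (p k) \<ominus>\<^bsub>\<Gamma> A\<^esub> sign (n + k) (r k)) \<ominus>\<^bsub>\<Gamma> A\<^esub> sign (n + k) (c k))"
    unfolding n_curvature_def p_def[symmetric] r_def[symmetric] c_def[symmetric] add.commute[of _ n]
    by (rule S.finsum_cong')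
      (use p r c in \<open>auto simp: sign_minus smult_closed intro!: S.minus_closed smult_closed\<close>)
  also have "\<dots> = (P \<ominus>\<^bsub>\<Gamma> A\<^esub> R) \<ominus>\<^bsub>\<Gamma> A\<^esub> C"
  proof -
    have "(\<Oplus>\<^bsub>\<Gamma> A\<^esub>k\<in>{1..n}. (sign (n + k) (p k) \<ominus>\<^bsub>\<Gamma> A\<^esub> sign (n + k) (r k)) \<ominus>\<^bsub>\<Gamma> A\<^esub> sign (n + k) (c k)) =
        (\<Oplus>\<^bsub>\<Gamma> A\<^esub>k\<in>{1..n}. sign (n + k) (p k) \<ominus>\<^bsub>\<Gamma> A\<^esub> sign (n + k) (r k)) \<ominus>\<^bsub>\<Gamma> A\<^esub> C"
      unfolding C_def by (rule S.finsum_diff) (use p r c smult_closed in auto)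
    also have "(\<Oplus>\<^bsub>\<Gamma> A\<^esub>k\<in>{1..n}. sign (n + k) (p k) \<ominus>\<^bsub>\<Gamma> A\<^esub> sign (n + k) (r k)) = P \<ominus>\<^bsub>\<Gamma> A\<^esub> R"
      unfolding P_def R_def by (rule S.finsum_diff) (use p r smult_closed in auto)
    finally show ?thesis .
  qed
  finally have K: "(\<Oplus>\<^bsub>\<Gamma> A\<^esub>k\<in>{1..n}. sign (k + n) (n_curvature n A D Xs (omit k Ys) (Ys ! (k - 1)))) =
      (P \<ominus>\<^bsub>\<Gamma> A\<^esub> R) \<ominus>\<^bsub>\<Gamma> A\<^esub> C" .

  have "(P \<ominus>\<^bsub>\<Gamma> A\<^esub> R) \<ominus>\<^bsub>\<Gamma> A\<^esub> C \<oplus>\<^bsub>\<Gamma> A\<^esub> Q \<ominus>\<^bsub>\<Gamma> A\<^esub> T =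
      (P \<oplus>\<^bsub>\<Gamma> A\<^esub> Q) \<ominus>\<^bsub>\<Gamma> A\<^esub> (R \<oplus>\<^bsub>\<Gamma> A\<^esub> T \<oplus>\<^bsub>\<Gamma> A\<^esub> C)"
    using PRCT Q by (simp add: a_minus_def S.minus_add S.a_ac)
  moreover have "(P \<oplus>\<^bsub>\<Gamma> A\<^esub> Q) \<ominus>\<^bsub>\<Gamma> A\<^esub> (R \<oplus>\<^bsub>\<Gamma> A\<^esub> T \<oplus>\<^bsub>\<Gamma> A\<^esub> C) = \<zero>\<^bsub>\<Gamma> A\<^esub> \<longleftrightarrow>
      P \<oplus>\<^bsub>\<Gamma> A\<^esub> Q = R \<oplus>\<^bsub>\<Gamma> A\<^esub> T \<oplus>\<^bsub>\<Gamma> A\<^esub> C"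
    using PRCT Q by (intro S.minus_eq_zero_iff) auto
  ultimately show ?thesis
    unfolding L FR[unfolded b_def] K Q_def[symmetric] s_def[symmetric] T_def[symmetric] by simp
qed

end


theorem proposition2p4:
  fixes n :: nat
    and A :: "('m, 'e) bundle_data"
    and \<aa> :: "'m \<Rightarrow> 'e list \<Rightarrow> ('m \<Rightarrow> real) \<Rightarrow> real"
    and D :: "('m \<Rightarrow> 'e) list \<Rightarrow> ('m \<Rightarrow> 'e) \<Rightarrow> 'm \<Rightarrow> 'e"
  assumes "n \<ge> 2"
    and "n_anchored_bundle n A \<aa>"
    and "n_connection n A \<aa> D"
  shows
    "(\<forall>Xs\<in>section_lists A (n - 1). \<forall>Ys\<in>section_lists A n.
        n_bracket n A D (Xs @ [n_bracket n A D Ys]) =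
        (\<Oplus>\<^bsub>\<Gamma> A\<^esub>k\<in>{1..n}.
           n_bracket n A D (Ys[k - 1 := n_bracket n A D (Xs @ [Ys ! (k - 1)])])))
     \<longleftrightarrow>
     (\<forall>Xs\<in>section_lists A (n - 1). \<forall>Ys\<in>section_lists A n.
        (\<Oplus>\<^bsub>\<Gamma> A\<^esub>k\<in>{1..n}.
           real_smult A ((-1) ^ (k + n)) (n_curvature n A D Xs (omit k Ys) (Ys ! (k - 1))))
        \<oplus>\<^bsub>\<Gamma> A\<^esub>
        (\<Oplus>\<^bsub>\<Gamma> A\<^esub>l\<in>{1..n - 1}.
           real_smult A ((-1) ^ l) (D (n_bracket n A D Ys # omit l Xs) (Xs ! (l - 1))))
        \<ominus>\<^bsub>\<Gamma> A\<^esub>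
        (\<Oplus>\<^bsub>\<Gamma> A\<^esub>l\<in>{1..n - 1}. \<Oplus>\<^bsub>\<Gamma> A\<^esub>k\<in>{1..n}.
           real_smult A ((-1) ^ (k + l))
             (D (omit k Ys) (D (omit l Xs @ [Ys ! (k - 1)]) (Xs ! (l - 1)))))
        = \<zero>\<^bsub>\<Gamma> A\<^esub>)"
proof -
  interpret bundle_with_connection n A \<aa> D
    using assms by unfold_locales
  show ?thesis
    by (rule ball_cong[OF refl], rule ball_cong[OF refl]) (rule fundamental_identity_iff_Bianchi)
qed

end
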